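(* Let $\varphi=\Phi I\in H^\infty$, where $I$ is inner and $\Phi$ is outer. If for every $0<\delta<1$ the interior of $L_\Phi^+(\delta)$ has nonempty intersection with $\sigma(I)$, then $\varphi$ is saturated.
   Context: $\mathbb{T}$ is the unit circle with normalized Lebesgue measure; $H^p$ ($1\le p\le\infty$) is the subspace of $L^p(\mathbb{T})$ of functions with Fourier coefficients supported on $\{0,1,2,\dots\}$, and $H^\infty_0$ is the subspace of $H^\infty$ of functions vanishing at the origin. A function $\varphi\in H^\infty$ is saturated if $\|\varphi\|_\infty = \inf_{f\in H^\infty_0}\|\varphi-\overline{f}\|_\infty$. Every $\varphi \in H^\infty$ factors as $\varphi=\Phi I$ with $I$ inner ($|I|=1$ a.e. on $\mathbb{T}$) and $\Phi$ outer. For a bounded function $\psi$ and $0\le\delta\le1$, $L_\psi^+(\delta)=\{e^{i\theta}\in\mathbb{T}: |\psi(e^{i\theta})|\ge \|\psi\|_\infty\delta\}$ (interior taken in $\mathbb{T}$). Writing $I=BS$ with $B$ a Blaschke product and $S$ singular inner, the spectrum $\sigma(I)\subseteq\mathbb{T}$ is the union of the accumulation points of the zeros of $B$ and the support of the singular measure of $S$. *)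

theory Defs
  imports "HOL-Probability.Probability"
begin

definition circle_measure :: "complex measure" where
  "circle_measure = distr (uniform_measure lborel {0..2*pi}) borel cis"

definition fourier_coeff :: "(complex \<Rightarrow> complex) \<Rightarrow> int \<Rightarrow> complex" where
  "fourier_coeff f n = integral\<^sup>L circle_measure (\<lambda>z. f z * z powi (-n))"

definition linf_norm :: "(complex \<Rightarrow> complex) \<Rightarrow> real" where
  "linf_norm f = real_of_ereal (esssup circle_measure (\<lambda>z. ereal (cmod (f z))))"

definition Linf :: "(complex \<Rightarrow> complex) set" where
  "Linf = {f. f \<in> borel_measurable circle_measure \<and>
              esssup circle_measure (\<lambda>z. ereal (cmod (f z))) < \<infinity>}"

definition Hinf :: "(complex \<Rightarrow> complex) set" where
  "Hinf = {f. f \<in> Linf \<and> (\<forall>n::int. n < 0 \<longrightarrow> fourier_coeff f n = 0)}"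

definition Hinf0 :: "(complex \<Rightarrow> complex) set" where
  "Hinf0 = {f. f \<in> Hinf \<and> fourier_coeff f 0 = 0}"

definition H1 :: "(complex \<Rightarrow> complex) set" where
  "H1 = {f. integrable circle_measure f \<and> (\<forall>n::int. n < 0 \<longrightarrow> fourier_coeff f n = 0)}"

definition saturated :: "(complex \<Rightarrow> complex) \<Rightarrow> bool" where
  "saturated \<phi> \<longleftrightarrow>
     linf_norm \<phi> = Inf {linf_norm (\<lambda>z. \<phi> z - cnj (f z)) | f. f \<in> Hinf0}"

text \<open>Extension to the open unit disc (Cauchy integral of the boundary function).\<close>
definition disc_ext :: "(complex \<Rightarrow> complex) \<Rightarrow> complex \<Rightarrow> complex" where
  "disc_ext f z = integral\<^sup>L circle_measure (\<lambda>\<zeta>. f \<zeta> / (1 - z * cnj \<zeta>))"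

definition inner_fun :: "(complex \<Rightarrow> complex) \<Rightarrow> bool" where
  "inner_fun I \<longleftrightarrow> I \<in> Hinf \<and> (AE z in circle_measure. cmod (I z) = 1)"

definition outer_fun :: "(complex \<Rightarrow> complex) \<Rightarrow> bool" where
  "outer_fun F \<longleftrightarrow> F \<in> H1 \<and>
     (\<exists>c k. cmod c = 1 \<and> integrable circle_measure (k :: complex \<Rightarrow> real) \<and>
        (\<forall>z\<in>ball 0 1. disc_ext F z =
            c * exp (integral\<^sup>L circle_measure (\<lambda>\<zeta>. (\<zeta> + z) / (\<zeta> - z) * of_real (k \<zeta>)))))"

fun blaschke_factor :: "complex option \<Rightarrow> complex \<Rightarrow> complex" where
  "blaschke_factor None z = 1"
| "blaschke_factor (Some a) z =
     (if a = 0 then z else (of_real (cmod a) / a) * (a - z) / (1 - cnj a * z))"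

definition blaschke_seq :: "(nat \<Rightarrow> complex option) \<Rightarrow> bool" where
  "blaschke_seq a \<longleftrightarrow> (\<forall>n b. a n = Some b \<longrightarrow> cmod b < 1) \<and>
     summable (\<lambda>n. case a n of None \<Rightarrow> 0 | Some b \<Rightarrow> 1 - cmod b)"

definition blaschke_prod :: "(nat \<Rightarrow> complex option) \<Rightarrow> complex \<Rightarrow> complex" where
  "blaschke_prod a z = (\<Prod>n. blaschke_factor (a n) z)"

definition singular_meas :: "complex measure \<Rightarrow> bool" where
  "singular_meas \<mu> \<longleftrightarrow> sets \<mu> = sets borel \<and> finite_measure \<mu> \<and>
     emeasure \<mu> (UNIV - sphere 0 1) = 0 \<and>
     (\<exists>A\<in>sets borel. emeasure circle_measure A = 0 \<and> emeasure \<mu> (UNIV - A) = 0)"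

definition singular_inner :: "complex measure \<Rightarrow> complex \<Rightarrow> complex" where
  "singular_inner \<mu> z = exp (- integral\<^sup>L \<mu> (\<lambda>\<zeta>. (\<zeta> + z) / (\<zeta> - z)))"

definition inner_decomp ::
  "(complex \<Rightarrow> complex) \<Rightarrow> complex \<Rightarrow> (nat \<Rightarrow> complex option) \<Rightarrow> complex measure \<Rightarrow> bool" where
  "inner_decomp I c a \<mu> \<longleftrightarrow> cmod c = 1 \<and> blaschke_seq a \<and> singular_meas \<mu> \<and>
     (\<forall>z\<in>ball 0 1. disc_ext I z = c * blaschke_prod a z * singular_inner \<mu> z)"

definition measure_support :: "complex measure \<Rightarrow> complex set" where
  "measure_support \<mu> = {\<zeta> \<in> sphere 0 1. \<forall>e>0. emeasure \<mu> (ball \<zeta> e) > 0}"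

definition inner_spectrum :: "(nat \<Rightarrow> complex option) \<Rightarrow> complex measure \<Rightarrow> complex set" where
  "inner_spectrum a \<mu> =
     {\<zeta>. \<zeta> islimpt {b. \<exists>n. a n = Some b}} \<union> measure_support \<mu>"

definition Lplus :: "(complex \<Rightarrow> complex) \<Rightarrow> real \<Rightarrow> complex set" where
  "Lplus \<psi> \<delta> = {\<zeta> \<in> sphere 0 1. cmod (\<psi> \<zeta>) \<ge> linf_norm \<psi> * \<delta>}"

end

theory Submission
  imports Defs
begin

text \<open>
  Let \<open>P\<^sub>l\<close> be the Poisson kernel at a point \<open>l\<close> of the disc, \<open>M\<close> the norm of \<open>\<phi>\<close>, and write \<open>\<phi>(l)\<close>
  for the analytic extension. The function \<open>g = (\<phi> - \<phi>(l)) P\<^sub>l\<close> has no Fourier coefficients of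
  nonpositive index, so the integral of \<open>f g\<close> vanishes for every \<open>f\<close> in \<open>H\<^sup>\<infinity>\<close>. Testing
  \<open>\<phi> - cnj f\<close> against \<open>cnj g\<close> gives
  \<open>\<integral> |\<phi>|\<^sup>2 P\<^sub>l - |\<phi>(l)|\<^sup>2 \<le> \<parallel>\<phi> - cnj f\<parallel> (M + |\<phi>(l)|)\<close>.
  Let \<open>l\<close> tend to a point \<open>\<zeta>\<close> of the spectrum in the interior of \<open>Lplus \<Phi> \<delta>\<close> along points with
  \<open>I(l) \<rightarrow> 0\<close>. Then \<open>|\<phi>(l)| \<le> M |I(l)| \<rightarrow> 0\<close>, the first integral is asymptotically at least
  \<open>\<delta>\<^sup>2 M\<^sup>2\<close>, and hence \<open>\<delta>\<^sup>2 M \<le> \<parallel>\<phi> - cnj f\<parallel>\<close>; finally \<open>\<delta> \<rightarrow> 1\<close>.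

  Such points \<open>l\<close> exist near an accumulation point of zeros trivially. Near a point of the support
  of \<open>\<mu>\<close> they exist because otherwise the Poisson integral of \<open>\<mu>\<close> would be bounded there, making
  \<open>\<mu>\<close> locally absolutely continuous, against singularity.
\<close>

section \<open>Cauchy and Poisson integrals on the circle\<close>

lemma sets_circle_measure [simp, measurable_cong]: "sets circle_measure = sets borel"
  by (simp add: circle_measure_def)

lemma space_circle_measure [simp]: "space circle_measure = UNIV"
  by (simp add: circle_measure_def)

lemma measurable_cis_uniform [measurable]:
  "cis \<in> uniform_measure lborel {0..2*pi} \<rightarrow>\<^sub>M borel"
  using borel_measurable_continuous_onI[of cis] by (simp add: continuous_on_cis)

interpretation circle: prob_space circle_measure
  unfolding circle_measure_def
  by (intro prob_space.prob_space_distr prob_space_uniform_measure) auto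

lemma measurable_cnj [measurable]: "cnj \<in> borel_measurable borel"
  by (intro borel_measurable_continuous_onI continuous_intros)

lemma AE_circle_norm: "AE z in circle_measure. cmod z = 1"
  unfolding circle_measure_def by (subst AE_distr_iff) auto

text \<open>The antiderivative \<open>cis (n * t) / (\<i> * n)\<close> takes the same value at both
  ends of the period.\<close>

lemma circle_integral_power_eq_0:
  assumes "n > 0"
  shows "integral\<^sup>L circle_measure (\<lambda>z. z ^ n) = 0"
proof -
  have "integral\<^sup>L circle_measure (\<lambda>z. z ^ n)
      = integral\<^sup>L (uniform_measure lborel {0..2*pi}) (\<lambda>t. cis t ^ n)"
    unfolding circle_measure_def by (subst integral_distr) auto
  also have "\<dots> = (LINT t|density lborel (\<lambda>t. ennreal (indicator {0..2*pi} t / (2*pi))). cis t ^ n)"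
    unfolding uniform_measure_def
    by (intro arg_cong2[where f="integral\<^sup>L"] density_cong refl)
       (auto simp: indicator_def divide_ennreal[of 1 "2*pi", simplified])
  also have "\<dots> = (LINT t|lborel. (indicator {0..2*pi} t / (2*pi)) *\<^sub>R cis t ^ n)"
    by (subst integral_density) (auto intro!: borel_measurable_power borel_measurable_continuous_onI continuous_on_cis)
  also have "\<dots> = (1/(2*pi)) *\<^sub>R (LINT t|lborel. indicator {0..2*pi} t *\<^sub>R cis (real n * t))"
    by (subst integral_scaleR_right[symmetric])
       (auto simp: Complex.DeMoivre intro!: Bochner_Integration.integral_cong)
  also have "(LINT t|lborel. indicator {0..2*pi} t *\<^sub>R cis (real n * t))
     = cis (real n * (2*pi)) / (\<i> * real n) - cis (real n * 0) / (\<i> * real n)"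
  proof (rule integral_FTC_Icc)
    fix t :: real
    have "((\<lambda>z. exp (\<i> * of_nat n * z) / (\<i> * of_nat n)) has_field_derivative exp (\<i> * of_nat n * of_real t))
        (at (of_real t))"
      using assms by (auto intro!: derivative_eq_intros)
    then have "((\<lambda>t. exp (\<i> * of_nat n * of_real t) / (\<i> * of_nat n)) has_vector_derivative
        exp (\<i> * of_nat n * of_real t)) (at t within {0..2*pi})"
      by (rule has_vector_derivative_real_field)
    then show "((\<lambda>t. cis (real n * t) / (\<i> * complex_of_real (real n))) has_vector_derivative cis (real n * t))
        (at t within {0..2*pi})"
      by (simp add: cis_conv_exp mult_ac)
  qed (auto intro!: continuous_intros)
  also have "\<dots> = 0"
    using cis_multiple_2pi[of "real n"] by (simp add: mult_ac)
  finally show ?thesis by simp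
qed

text \<open>Expand the kernel into a geometric series; sum and integral may be exchanged because the
  terms have norm \<open>cmod l ^ n * cmod (F z)\<close>. Keeping \<open>w\<close> abstract covers
  both halves of the Poisson kernel, with \<open>w z = z\<close> and \<open>w = cnj\<close>.\<close>

lemma geometric_sums_circle:
  assumes F: "integrable circle_measure F" and l: "cmod l < 1"
    and [measurable]: "w \<in> borel_measurable circle_measure"
    and w: "AE z in circle_measure. cmod (w z) = 1"
  shows "(\<lambda>n. l ^ n * (LINT z|circle_measure. F z * w z ^ n)) sums
           (LINT z|circle_measure. F z / (1 - l * w z))"
proof -
  have [measurable]: "F \<in> borel_measurable circle_measure" using F by auto
  define f where "f = (\<lambda>(n::nat) z. l ^ n * (F z * w z ^ n))"
  have fn: "AE z in circle_measure. norm (f n z) = cmod l ^ n * cmod (F z)" for n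
    using w by eventually_elim (simp add: f_def norm_mult norm_power)
  have int: "integrable circle_measure (f n)" for n
    unfolding f_def
    by (intro integrable_mult_right, rule Bochner_Integration.integrable_bound[OF F])
       (use w in \<open>auto simp: norm_mult norm_power\<close>)
  have "(\<lambda>n. LINT z|circle_measure. f n z) sums (LINT z|circle_measure. (\<Sum>n. f n z))"
  proof (rule sums_integral[OF int])
    have "AE z in circle_measure. \<forall>n. norm (f n z) = cmod l ^ n * cmod (F z)"
      using fn by (simp add: AE_all_countable)
    then show "AE z in circle_measure. summable (\<lambda>n. norm (f n z))"
      by eventually_elim (use l in \<open>auto intro!: summable_mult2 summable_geometric\<close>)
    have "(LINT z|circle_measure. norm (f n z)) = cmod l ^ n * (LINT z|circle_measure. cmod (F z))" for n
      by (subst integral_cong_AE[OF _ _ fn]) (auto simp: f_def)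
    then show "summable (\<lambda>n. LINT z|circle_measure. norm (f n z))"
      using l by (auto intro!: summable_mult2 summable_geometric)
  qed
  also have "(LINT z|circle_measure. (\<Sum>n. f n z)) = (LINT z|circle_measure. F z / (1 - l * w z))"
  proof (rule integral_cong_AE)
    show "AE z in circle_measure. (\<Sum>n. f n z) = F z / (1 - l * w z)"
      using w
    proof eventually_elim
      case (elim z)
      have "(\<lambda>n. F z * (l * w z) ^ n) sums (F z * (1 / (1 - l * w z)))"
        using l elim by (intro sums_mult geometric_sums) (simp add: norm_mult)
      then show ?case
        by (intro sums_unique[symmetric]) (simp add: f_def power_mult_distrib mult_ac)
    qed
  qed (auto simp: f_def)
  finally show ?thesis by (simp add: f_def)
qed

section \<open>The Poisson kernel and its splitting into Cauchy kernels\<close>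

definition poisson :: "complex \<Rightarrow> complex \<Rightarrow> real" where
  "poisson z \<zeta> = (1 - (cmod z)\<^sup>2) / (cmod (\<zeta> - z))\<^sup>2"

lemma poisson_nonneg: "cmod z < 1 \<Longrightarrow> 0 \<le> poisson z \<zeta>"
  by (simp add: poisson_def abs_square_le_1)

lemma measurable_poisson [measurable]: "poisson z \<in> borel_measurable borel"
  unfolding poisson_def by measurable

lemma poisson_le:
  assumes z: "cmod z < 1" and "cmod \<zeta> = 1"
  shows "poisson z \<zeta> \<le> (1 + cmod z) / (1 - cmod z)"
proof -
  have "1 - cmod z \<le> cmod (\<zeta> - z)"
    using norm_triangle_ineq2[of \<zeta> z] assms by simp
  then have "(1 - cmod z)\<^sup>2 \<le> (cmod (\<zeta> - z))\<^sup>2"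
    using z by (intro power_mono) auto
  then have "poisson z \<zeta> \<le> (1 - (cmod z)\<^sup>2) / (1 - cmod z)\<^sup>2"
    unfolding poisson_def using z by (intro divide_left_mono) (auto simp: abs_square_le_1 intro!: mult_pos_pos)
  also have "\<dots> = (1 + cmod z) / (1 - cmod z)"
    using z by (simp add: power2_eq_square square_diff_one_factored divide_simps) (simp add: algebra_simps)
  finally show ?thesis .
qed

text \<open>On the circle the squared distance factors as
  \<open>(1 - z * cnj \<zeta>) * (1 - cnj z * \<zeta>)\<close>. In the resulting partial fractions
  the second term contains only positive powers of \<zeta>, which functions in \<open>H1\<close>
  annihilate.\<close>

lemma poisson_cauchy:
  assumes "cmod z < 1" and \<zeta>: "cmod \<zeta> = 1"
  shows "complex_of_real (poisson z \<zeta>) =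
           1 / (1 - z * cnj \<zeta>) + cnj z * \<zeta> / (1 - cnj z * \<zeta>)"
proof -
  have zz: "\<zeta> * cnj \<zeta> = 1" using \<zeta> by (simp add: complex_norm_square[symmetric])
  have n: "1 - z * cnj \<zeta> \<noteq> 0" "1 - cnj z * \<zeta> \<noteq> 0"
    using assms by (metis complex_mod_cnj mult.right_neutral norm_mult norm_one order_less_irrefl right_minus_eq)+
  have "complex_of_real ((cmod (\<zeta> - z))\<^sup>2) = (\<zeta> - z) * cnj (\<zeta> - z)"
    by (rule complex_norm_square)
  also have "\<dots> = (1 - z * cnj \<zeta>) * (1 - cnj z * \<zeta>)"
    using zz by (simp add: algebra_simps)
  finally have d: "complex_of_real ((cmod (\<zeta> - z))\<^sup>2) = (1 - z * cnj \<zeta>) * (1 - cnj z * \<zeta>)" .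
  have "complex_of_real (poisson z \<zeta>) = (1 - z * cnj z) / complex_of_real ((cmod (\<zeta> - z))\<^sup>2)"
    unfolding poisson_def of_real_divide of_real_diff complex_norm_square[of z] by simp
  also have "\<dots> = 1 / (1 - z * cnj \<zeta>) + cnj z * \<zeta> / (1 - cnj z * \<zeta>)"
    unfolding d using n zz by (simp add: divide_simps) (simp add: algebra_simps)
  finally show ?thesis .
qed

lemma integrable_bounded_circle:
  assumes "F \<in> borel_measurable circle_measure" "AE z in circle_measure. norm (F z) \<le> B"
  shows "integrable circle_measure (F :: complex \<Rightarrow> 'b :: {banach, second_countable_topology})"
  using circle.integrable_const_bound[OF assms(2,1)] .

lemma integrable_mult_bounded:
  fixes F G :: "complex \<Rightarrow> complex"
  assumes F: "integrable circle_measure F" and G: "G \<in> borel_measurable circle_measure"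
    and B: "AE z in circle_measure. norm (G z) \<le> B"
  shows "integrable circle_measure (\<lambda>z. F z * G z)"
proof (rule Bochner_Integration.integrable_bound)
  show "integrable circle_measure (\<lambda>z. B * cmod (F z))" using F by simp
  show "(\<lambda>z. F z * G z) \<in> borel_measurable circle_measure" using F G by auto
  show "AE z in circle_measure. norm (F z * G z) \<le> norm (B * cmod (F z))"
    using B
  proof eventually_elim
    case (elim z)
    have "norm (F z * G z) \<le> cmod (F z) * B"
      using elim by (simp add: norm_mult mult_left_mono)
    also have "\<dots> \<le> norm (B * cmod (F z))" by (simp add: mult.commute)
    finally show ?case .
  qed
qed

lemma norm_inverse_one_minus_le:
  assumes "cmod l < 1" "cmod w = 1"
  shows "norm (1 / (1 - l * w)) \<le> 1 / (1 - cmod l)"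
proof -
  have "1 - cmod l \<le> cmod (1 - l * w)"
    using norm_triangle_ineq2[of 1 "l * w"] assms by (simp add: norm_mult)
  then show ?thesis using assms by (auto simp: norm_divide intro!: divide_left_mono mult_pos_pos)
qed

lemma integrable_cauchy_kernel:
  assumes F: "integrable circle_measure F" and l: "cmod l < 1"
    and [measurable]: "w \<in> borel_measurable circle_measure"
    and w: "AE z in circle_measure. cmod (w z) = 1"
  shows "integrable circle_measure (\<lambda>z. F z * z ^ k / (1 - l * w z))"
proof -
  have "AE z in circle_measure. norm (z ^ k * (1 / (1 - l * w z))) \<le> 1 / (1 - cmod l)"
    using w AE_circle_norm
  proof eventually_elim
    case (elim z)
    then show ?case using norm_inverse_one_minus_le[OF l elim(1)]
      by (simp only: norm_mult norm_power) simp
  qed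
  then have "integrable circle_measure (\<lambda>z. F z * (z ^ k * (1 / (1 - l * w z))))"
    by (intro integrable_mult_bounded[OF F, where B = "1 / (1 - cmod l)"]) measurable
  then show ?thesis by simp
qed

lemma integrable_mult_power:
  assumes "integrable circle_measure F"
  shows "integrable circle_measure (\<lambda>z. F z * z ^ k)"
  using integrable_cauchy_kernel[OF assms, of 0 "\<lambda>z. z" k] AE_circle_norm by simp

section \<open>Moments of Hardy functions against the Cauchy and Poisson kernels\<close>

lemma H1_moment_eq_0:
  assumes "F \<in> H1" "k > 0"
  shows "(LINT z|circle_measure. F z * z ^ k) = 0"
proof -
  have "fourier_coeff F (- int k) = 0" using assms by (simp add: H1_def)
  then show ?thesis by (simp add: fourier_coeff_def)
qed

text \<open>Since \<open>z * cnj z = 1\<close>, raising \<open>k\<close> by one splits the integrand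
  into the positive power \<open>z ^ Suc k\<close>, which pairs with \<open>F\<close> to 0, and
  \<open>l\<close> times the previous integrand.\<close>

lemma cauchy_moment:
  assumes F: "F \<in> H1" and l: "cmod l < 1"
  shows "(LINT z|circle_measure. F z * z ^ k / (1 - l * cnj z)) = l ^ k * disc_ext F l"
proof (induction k)
  case 0
  then show ?case by (simp add: disc_ext_def)
next
  case (Suc k)
  have Fi: "integrable circle_measure F" using F by (simp add: H1_def)
  have "(LINT z|circle_measure. F z * z ^ Suc k / (1 - l * cnj z)) =
        (LINT z|circle_measure. F z * z ^ Suc k + l * (F z * z ^ k / (1 - l * cnj z)))"
  proof (rule integral_cong_AE)
    show "AE z in circle_measure. F z * z ^ Suc k / (1 - l * cnj z) =
       F z * z ^ Suc k + l * (F z * z ^ k / (1 - l * cnj z))"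
      using AE_circle_norm
    proof eventually_elim
      case (elim z)
      have zz: "z * cnj z = 1" using elim by (simp add: complex_norm_square[symmetric])
      have n: "1 - l * cnj z \<noteq> 0"
        using elim l by (metis complex_mod_cnj mult.right_neutral norm_mult norm_one order_less_irrefl right_minus_eq)
      have "F z * z ^ Suc k * (1 - l * cnj z) + l * (F z * z ^ k)
          = F z * z ^ Suc k - F z * z ^ k * l * (z * cnj z) + l * (F z * z ^ k)"
        by (simp add: algebra_simps)
      then show ?case using n zz by (simp add: divide_simps)
    qed
  qed (use Fi in auto)
  also have "\<dots> = (LINT z|circle_measure. F z * z ^ Suc k)
      + l * (LINT z|circle_measure. F z * z ^ k / (1 - l * cnj z))"
  proof (subst Bochner_Integration.integral_add)
    show "integrable circle_measure (\<lambda>z. F z * z ^ Suc k)"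
      using Fi by (rule integrable_mult_power)
    show "integrable circle_measure (\<lambda>z. l * (F z * z ^ k / (1 - l * cnj z)))"
      by (intro integrable_mult_right integrable_cauchy_kernel Fi l) (auto simp: AE_circle_norm)
  qed (simp only: integral_mult_right_zero)
  finally show ?case using Suc.IH H1_moment_eq_0[OF F, of "Suc k"] by simp
qed

text \<open>Of the two parts in \<open>poisson_cauchy\<close>, the one with positive powers of
  \<open>z\<close> integrates to 0 term by term, and the Cauchy part is
  \<open>cauchy_moment\<close>. For \<open>k = 0\<close> this is the Poisson representation of the
  extension.\<close>

lemma poisson_moment:
  assumes F: "F \<in> H1" and l: "cmod l < 1"
  shows "(LINT z|circle_measure. F z * z ^ k * of_real (poisson l z)) = l ^ k * disc_ext F l"
proof -
  have Fi: "integrable circle_measure F" using F by (simp add: H1_def)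
  have Fk: "integrable circle_measure (\<lambda>z. F z * z ^ Suc k)"
    using Fi by (rule integrable_mult_power)
  have "(\<lambda>n. cnj l ^ n * (LINT z|circle_measure. F z * z ^ Suc k * z ^ n)) sums
           (LINT z|circle_measure. F z * z ^ Suc k / (1 - cnj l * z))"
    using l by (intro geometric_sums_circle Fk) (auto simp: AE_circle_norm)
  moreover have "(LINT z|circle_measure. F z * z ^ Suc k * z ^ n) = 0" for n
    using H1_moment_eq_0[OF F, of "Suc (k + n)"] by (simp add: power_add mult_ac)
  ultimately have 0: "(LINT z|circle_measure. F z * z ^ Suc k / (1 - cnj l * z)) = 0"
    by (simp add: sums_iff)
  have "(LINT z|circle_measure. F z * z ^ k * of_real (poisson l z)) =
    (LINT z|circle_measure. F z * z ^ k / (1 - l * cnj z) + cnj l * (F z * z ^ Suc k / (1 - cnj l * z)))"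
  proof (rule integral_cong_AE)
    show "AE z in circle_measure. F z * z ^ k * of_real (poisson l z) =
       F z * z ^ k / (1 - l * cnj z) + cnj l * (F z * z ^ Suc k / (1 - cnj l * z))"
      using AE_circle_norm by eventually_elim (simp add: poisson_cauchy[OF l] algebra_simps)
  qed (use Fi in auto)
  also have "\<dots> = (LINT z|circle_measure. F z * z ^ k / (1 - l * cnj z))
     + cnj l * (LINT z|circle_measure. F z * z ^ Suc k / (1 - cnj l * z))"
  proof (subst Bochner_Integration.integral_add)
    show "integrable circle_measure (\<lambda>z. F z * z ^ k / (1 - l * cnj z))"
      by (intro integrable_cauchy_kernel Fi l) (auto simp: AE_circle_norm)
    show "integrable circle_measure (\<lambda>z. cnj l * (F z * z ^ Suc k / (1 - cnj l * z)))"
      using l by (intro integrable_mult_right integrable_cauchy_kernel Fi) (auto simp: AE_circle_norm)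
  qed (simp only: integral_mult_right_zero)
  finally show ?thesis by (simp only: 0 cauchy_moment[OF F l]) simp
qed

text \<open>The constant 1 is fed to \<open>poisson_moment\<close> to get the total mass of the
  Poisson kernel and, later, its moments \<open>l ^ k\<close>.\<close>

lemma one_in_H1: "(\<lambda>_. 1) \<in> H1"
proof -
  have "(LINT z|circle_measure. z powi (-n)) = 0" if "n < 0" for n :: int
  proof -
    have "n = - int (nat (-n))" "nat (-n) > 0" using that by auto
    then obtain k where "n = - int k" "k > 0" by blast
    then show ?thesis
      using circle_integral_power_eq_0[of k] by simp
  qed
  then show ?thesis by (simp add: H1_def fourier_coeff_def)
qed

lemma disc_ext_one: 
  assumes "cmod l < 1"
  shows "disc_ext (\<lambda>_. 1) l = 1"
proof -
  have "(\<lambda>n. l ^ n * (LINT z|circle_measure. 1 * cnj z ^ n)) sums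
           (LINT z|circle_measure. 1 / (1 - l * cnj z))"
    using assms by (intro geometric_sums_circle) (auto simp: AE_circle_norm)
  moreover have "(LINT z|circle_measure. 1 * cnj z ^ n) = (if n = 0 then 1 else 0)" for n
  proof -
    have "(LINT z|circle_measure. cnj z ^ n) = cnj (LINT z|circle_measure. z ^ n)"
      using Bochner_Integration.integral_cnj[of circle_measure "\<lambda>z. z ^ n"] by simp
    then show ?thesis using circle_integral_power_eq_0[of n] circle.prob_space by auto
  qed
  ultimately have "(\<lambda>n. l ^ n * (if n = 0 then 1 else 0)) sums disc_ext (\<lambda>_. 1) l"
    by (simp add: disc_ext_def)
  moreover have "(\<lambda>n. l ^ n * (if n = 0 then 1 else 0)) = (\<lambda>n. if n = 0 then 1 else 0)"
    by auto
  ultimately show ?thesis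
    using sums_If_finite_set[of "{0}" "\<lambda>_. 1::complex"] by (simp add: sums_unique2 sums_single)
qed

section \<open>The Poisson kernel as an approximate identity\<close>

lemma integrable_poisson:
  assumes "cmod l < 1"
  shows "integrable circle_measure (poisson l)"
  using AE_circle_norm poisson_nonneg[OF assms] poisson_le[OF assms]
  by (intro integrable_bounded_circle[where B = "(1 + cmod l) / (1 - cmod l)"])
     (auto elim!: eventually_mono)

lemma integral_poisson:
  assumes "cmod l < 1"
  shows "(LINT z|circle_measure. poisson l z) = 1"
proof -
  have "complex_of_real (LINT z|circle_measure. poisson l z) = 1"
    using poisson_moment[OF one_in_H1 assms, of 0] disc_ext_one[OF assms]
    by (simp del: of_real_eq_1_iff)
  then show ?thesis by simp
qed

lemma norm_integral_poisson_le:
  fixes F :: "complex \<Rightarrow> complex"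
  assumes "cmod l < 1" and [measurable]: "F \<in> borel_measurable borel"
    and B: "AE z in circle_measure. cmod (F z) \<le> B"
  shows "cmod (LINT z|circle_measure. F z * of_real (poisson l z)) \<le> B"
proof -
  have "cmod (LINT z|circle_measure. F z * of_real (poisson l z))
      \<le> (LINT z|circle_measure. cmod (F z * of_real (poisson l z)))"
    by (rule integral_norm_bound)
  also have "\<dots> \<le> (LINT z|circle_measure. B * poisson l z)"
  proof (rule integral_mono_AE)
    have "integrable circle_measure (\<lambda>z. of_real (poisson l z) * F z)"
      by (rule integrable_mult_bounded[OF _ _ B]) (use integrable_poisson[OF assms(1)] in auto)
    then show "integrable circle_measure (\<lambda>z. cmod (F z * of_real (poisson l z)))"
      by (simp add: mult.commute)
    show "integrable circle_measure (\<lambda>z. B * poisson l z)"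
      using integrable_poisson[OF assms(1)] by simp
    show "AE z in circle_measure. cmod (F z * of_real (poisson l z)) \<le> B * poisson l z"
      using B by eventually_elim (simp add: norm_mult mult_right_mono poisson_nonneg[OF assms(1)])
  qed
  finally show ?thesis using integral_poisson[OF assms(1)] by simp
qed

text \<open>Off \<open>U\<close> the denominator is at least \<open>(e / 2)\<^sup>2\<close>, while
  the numerator \<open>1 - (cmod l)\<^sup>2\<close> is at most twice the distance from
  \<open>l\<close> to \<zeta>; together these give the constant 8. A general \<open>U\<close> is
  allowed so that both balls and arbitrary open sets can be inserted.\<close>

lemma integral_poisson_off_ball_le:
  assumes l: "cmod l < 1" and \<zeta>: "cmod \<zeta> = 1" and e: "e > 0" and le: "dist l \<zeta> < e / 2"
    and U: "U \<in> sets borel" "ball \<zeta> e \<inter> sphere 0 1 \<subseteq> U"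
  shows "(LINT z|circle_measure. indicator (- U) z * poisson l z) \<le> 8 * dist l \<zeta> / e\<^sup>2"
proof -
  have [measurable]: "U \<in> sets borel" "- U \<in> sets borel" using U by auto
  have "(LINT z|circle_measure. indicator (- U) z * poisson l z)
      \<le> (LINT z|circle_measure. 8 * dist l \<zeta> / e\<^sup>2)"
  proof (rule integral_mono_AE)
    show "integrable circle_measure (\<lambda>z. indicator (- U) z * poisson l z)"
      by (rule Bochner_Integration.integrable_bound[OF integrable_poisson[OF l]])
         (auto simp: indicator_def poisson_nonneg[OF l])
    show "AE z in circle_measure. indicator (- U) z * poisson l z \<le> 8 * dist l \<zeta> / e\<^sup>2"
      using AE_circle_norm
    proof eventually_elim
      case (elim z)
      show ?case
      proof (cases "z \<in> U")
        case False
        then have "dist \<zeta> z \<ge> e" using U elim by (force simp: subset_iff)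
        then have ge: "cmod (z - l) \<ge> e / 2"
          using le dist_triangle[of \<zeta> z l] by (simp add: dist_norm norm_minus_commute)
        then have "(e / 2)\<^sup>2 \<le> (cmod (z - l))\<^sup>2" using e by (intro power_mono) auto
        then have "poisson l z \<le> (1 - (cmod l)\<^sup>2) / (e / 2)\<^sup>2"
          unfolding poisson_def using l ge e
          by (intro divide_left_mono mult_pos_pos) (auto simp: abs_square_le_1)
        also have "1 - (cmod l)\<^sup>2 \<le> 2 * dist l \<zeta>"
        proof -
          have "1 - cmod l \<le> dist l \<zeta>"
            using norm_triangle_ineq2[of \<zeta> l] \<zeta> by (simp add: dist_norm norm_minus_commute)
          then have "(1 - cmod l) * (1 + cmod l) \<le> dist l \<zeta> * 2"
            using l by (intro mult_mono) auto
          then show ?thesis by (simp add: power2_eq_square algebra_simps)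
        qed
        finally have "poisson l z \<le> 2 * dist l \<zeta> / (e / 2)\<^sup>2"
          by (simp add: divide_right_mono)
        then show ?thesis using False by (simp add: power_divide field_simps)
      qed auto
    qed
  qed auto
  then show ?thesis by (simp add: circle.prob_space[simplified])
qed

lemma integral_poisson_near_ge:
  assumes l: "cmod l < 1" and \<zeta>: "cmod \<zeta> = 1" and e: "e > 0" and le: "dist l \<zeta> < e / 2"
    and U: "U \<in> sets borel" "ball \<zeta> e \<inter> sphere 0 1 \<subseteq> U"
  shows "(LINT z|circle_measure. indicator U z * poisson l z) \<ge> 1 - 8 * dist l \<zeta> / e\<^sup>2"
proof -
  have [measurable]: "U \<in> sets borel" "- U \<in> sets borel" using U by auto
  have i: "integrable circle_measure (\<lambda>z. indicator A z * poisson l z)" if "A \<in> sets borel" for A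
    using that by (intro Bochner_Integration.integrable_bound[OF integrable_poisson[OF l]])
         (auto simp: indicator_def poisson_nonneg[OF l])
  have "(LINT z|circle_measure. indicator U z * poisson l z) +
        (LINT z|circle_measure. indicator (- U) z * poisson l z) = (LINT z|circle_measure. poisson l z)"
    by (subst Bochner_Integration.integral_add[symmetric, OF i i])
       (auto intro!: Bochner_Integration.integral_cong simp: indicator_def)
  then show ?thesis
    using integral_poisson_off_ball_le[OF assms] integral_poisson[OF l] by simp
qed

text \<open>On the torus this is the Poisson kernel of radius \<open>r\<close>; the cutoff by \<open>max\<close> makes it
  bounded and symmetric on the whole plane, as needed for Fubini.\<close>

definition pkernel :: "real \<Rightarrow> complex \<Rightarrow> complex \<Rightarrow> real" where
  "pkernel r \<zeta> \<xi> = (1 - r\<^sup>2) / max ((1 - r)\<^sup>2) ((cmod (1 - of_real r * \<zeta> * cnj \<xi>))\<^sup>2)"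

text \<open>Swapping the arguments conjugates the number whose modulus is taken. With Fubini this
  makes the Poisson averaging operator self-adjoint.\<close>

lemma pkernel_commute: "pkernel r \<zeta> \<xi> = pkernel r \<xi> \<zeta>"
proof -
  have "cmod (1 - of_real r * \<zeta> * cnj \<xi>) = cmod (cnj (1 - of_real r * \<zeta> * cnj \<xi>))"
    by (simp only: complex_mod_cnj)
  then show ?thesis by (simp add: pkernel_def mult_ac)
qed

lemma pkernel_bounds:
  assumes "0 \<le> r" "r < 1"
  shows "0 \<le> pkernel r \<zeta> \<xi>" "pkernel r \<zeta> \<xi> \<le> (1 - r\<^sup>2) / (1 - r)\<^sup>2"
proof -
  have "r\<^sup>2 \<le> 1" using assms by (simp add: abs_square_le_1)
  then show "0 \<le> pkernel r \<zeta> \<xi>" by (simp add: pkernel_def le_max_iff_disj)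
  have "0 < (1 - r)\<^sup>2" using assms by simp
  then show "pkernel r \<zeta> \<xi> \<le> (1 - r\<^sup>2) / (1 - r)\<^sup>2"
    unfolding pkernel_def using \<open>r\<^sup>2 \<le> 1\<close>
    by (intro divide_left_mono) (auto intro!: mult_pos_pos simp: less_max_iff_disj)
qed

lemma measurable_pkernel [measurable]:
  assumes [measurable]: "f \<in> borel_measurable M" "g \<in> borel_measurable M"
  shows "(\<lambda>x. pkernel r (f x) (g x)) \<in> borel_measurable M"
  unfolding pkernel_def by measurable

text \<open>The cutoff is inactive on the circle, because there \<open>1 - r\<close> is a lower
  bound of the modulus it is compared with.\<close>

lemma pkernel_eq_poisson:
  assumes r: "0 \<le> r" "r < 1" and "cmod \<zeta> = 1" "cmod \<xi> = 1"
  shows "pkernel r \<zeta> \<xi> = poisson (of_real r * \<zeta>) \<xi>"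
proof -
  have "\<xi> * cnj \<xi> = 1" using assms by (simp add: complex_norm_square[symmetric])
  then have "\<xi> - of_real r * \<zeta> = \<xi> * (1 - of_real r * \<zeta> * cnj \<xi>)"
    by (simp add: algebra_simps)
  then have eq: "cmod (\<xi> - of_real r * \<zeta>) = cmod (1 - of_real r * \<zeta> * cnj \<xi>)"
    using assms by (simp add: norm_mult)
  have "1 - r \<le> cmod (1 - of_real r * \<zeta> * cnj \<xi>)"
    using norm_triangle_ineq2[of 1 "of_real r * \<zeta> * cnj \<xi>"] assms by (simp add: norm_mult)
  then have "(1 - r)\<^sup>2 \<le> (cmod (1 - of_real r * \<zeta> * cnj \<xi>))\<^sup>2"
    using r by (intro power_mono) auto
  then show ?thesis using assms by (simp add: pkernel_def poisson_def eq max_def norm_mult)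
qed

lemma AE_pkernel_eq_poisson:
  assumes "0 \<le> r" "r < 1" and "cmod \<zeta> = 1"
  shows "AE \<xi> in circle_measure. pkernel r \<zeta> \<xi> = poisson (of_real r * \<zeta>) \<xi>"
  using AE_circle_norm by eventually_elim (rule pkernel_eq_poisson[OF assms])

lemma integral_pkernel:
  assumes "0 \<le> r" "r < 1" and "cmod \<zeta> = 1"
  shows "(LINT \<xi>|circle_measure. pkernel r \<zeta> \<xi>) = 1"
proof -
  have "(LINT \<xi>|circle_measure. pkernel r \<zeta> \<xi>) = (LINT \<xi>|circle_measure. poisson (of_real r * \<zeta>) \<xi>)"
    by (rule integral_cong_AE) (use AE_pkernel_eq_poisson[OF assms] in auto)
  then show ?thesis using assms by (simp add: integral_poisson norm_mult)
qed

lemma integrable_indicator_pkernel: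
  assumes "0 \<le> r" "r < 1" and [measurable]: "U \<in> sets borel"
  shows "integrable circle_measure (\<lambda>\<xi>. indicator U \<xi> * pkernel r \<zeta> \<xi>)"
  using pkernel_bounds[OF assms(1,2)] order_trans[OF pkernel_bounds[OF assms(1,2)]]
  by (intro integrable_bounded_circle[where B = "(1 - r\<^sup>2) / (1 - r)\<^sup>2"])
     (auto simp: indicator_def intro!: AE_I2)

lemma integral_indicator_pkernel_le_1:
  assumes r: "0 \<le> r" "r < 1" and [measurable]: "U \<in> sets borel" and z: "cmod \<zeta> = 1"
  shows "(LINT \<xi>|circle_measure. indicator U \<xi> * pkernel r \<zeta> \<xi>) \<le> 1"
proof -
  have "(LINT \<xi>|circle_measure. indicator U \<xi> * pkernel r \<zeta> \<xi>) \<le> (LINT \<xi>|circle_measure. pkernel r \<zeta> \<xi>)"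
    using integrable_indicator_pkernel[OF r, of U \<zeta>] integrable_indicator_pkernel[OF r, of UNIV \<zeta>]
    by (intro integral_mono) (auto simp: indicator_def pkernel_bounds r)
  then show ?thesis using integral_pkernel[OF r z] by simp
qed

text \<open>A ball around \<zeta> lies in \<open>U\<close>, and the radial point
  \<open>r n * \<zeta>\<close> has distance \<open>1 - r n\<close> from \<zeta>; so the mean is
  squeezed between \<open>1 - 8 * (1 - r n) / e\<^sup>2\<close> and 1.\<close>

lemma pkernel_open_tendsto_1:
  assumes r: "\<And>n. 0 \<le> r n" "\<And>n. r n < 1" "r \<longlonglongrightarrow> 1"
    and U: "open U" "\<zeta> \<in> U" "cmod \<zeta> = 1"
  shows "(\<lambda>n. LINT \<xi>|circle_measure. indicator U \<xi> * pkernel (r n) \<zeta> \<xi>) \<longlonglongrightarrow> 1"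
proof -
  have [measurable]: "U \<in> sets borel" using U by auto
  obtain e where e: "e > 0" "ball \<zeta> e \<subseteq> U" using U openE by blast
  let ?l = "\<lambda>n. of_real (r n) * \<zeta>"
  have d: "dist (?l n) \<zeta> = 1 - r n" for n
  proof -
    have "?l n - \<zeta> = of_real (r n - 1) * \<zeta>" by (simp add: algebra_simps)
    then show ?thesis using U r(2)[of n] by (simp add: dist_norm norm_mult del: of_real_diff)
  qed
  have eq: "(LINT \<xi>|circle_measure. indicator U \<xi> * pkernel (r n) \<zeta> \<xi>) =
      (LINT \<xi>|circle_measure. indicator U \<xi> * poisson (?l n) \<xi>)" for n
    by (rule integral_cong_AE) (use AE_pkernel_eq_poisson[OF r(1,2) U(3), of n] in auto)
  show ?thesis
  proof (rule tendsto_sandwich)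
    have "eventually (\<lambda>n. 1 - r n < e / 2) sequentially"
      using order_tendstoD(1)[OF r(3), of "1 - e/2"] e by (auto elim!: eventually_mono)
    then show "eventually (\<lambda>n. 1 - 8 * (1 - r n) / e\<^sup>2 \<le> (LINT \<xi>|circle_measure. indicator U \<xi> * pkernel (r n) \<zeta> \<xi>)) sequentially"
    proof eventually_elim
      case (elim n)
      have "cmod (?l n) < 1" using r U by (simp add: norm_mult)
      from integral_poisson_near_ge[OF this U(3) e(1), of U] e elim
      show ?case unfolding eq d by auto
    qed
    show "eventually (\<lambda>n. (LINT \<xi>|circle_measure. indicator U \<xi> * pkernel (r n) \<zeta> \<xi>) \<le> 1) sequentially"
      by (intro always_eventually allI integral_indicator_pkernel_le_1 r U) simp
    have "(\<lambda>n. 1 - 8 * (1 - r n) / e\<^sup>2) \<longlonglongrightarrow> 1 - 8 * (1 - 1) / e\<^sup>2"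
      using e by (intro tendsto_intros r) auto
    then show "(\<lambda>n. 1 - 8 * (1 - r n) / e\<^sup>2) \<longlonglongrightarrow> 1" by simp
  qed auto
qed

section \<open>Weak-star convergence of Poisson means\<close>

interpretation circle_pair: pair_prob_space circle_measure circle_measure ..

lemma integrable_circle_pair:
  fixes f :: "complex \<Rightarrow> complex \<Rightarrow> 'b :: {banach, second_countable_topology}"
  assumes "case_prod f \<in> borel_measurable (circle_measure \<Otimes>\<^sub>M circle_measure)"
    and "\<And>x y. norm (f x y) \<le> B"
  shows "integrable (circle_measure \<Otimes>\<^sub>M circle_measure) (case_prod f)"
  using assms by (intro circle_pair.integrable_const_bound[where B = B]) auto

text \<open>Pointwise convergence is known on \<open>U\<close>, and conservation of mass handles the
  complement: by symmetry of the kernel \<open>Q n\<close> has the same integral as the indicator,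
  and \<open>Q n\<close> lies between 0 and 1, so the mass lost on \<open>U\<close> equals the mass
  gained outside. The L1 distance is therefore twice the loss on \<open>U\<close>, which tends to 0
  by dominated convergence.\<close>

lemma pkernel_open_tendsto_L1:
  assumes r: "\<And>n. 0 \<le> r n" "\<And>n. r n < 1" "r \<longlonglongrightarrow> 1" and U: "open U"
  defines "Q \<equiv> \<lambda>n \<zeta>. LINT \<xi>|circle_measure. indicator U \<xi> * pkernel (r n) \<zeta> \<xi>"
  shows "(\<lambda>n. LINT \<zeta>|circle_measure. \<bar>Q n \<zeta> - indicator U \<zeta>\<bar>) \<longlonglongrightarrow> 0"
proof -
  have [measurable]: "U \<in> sets borel" using U by auto
  have Qm [measurable]: "Q n \<in> borel_measurable borel" for n unfolding Q_def by measurable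
  have Q0: "0 \<le> Q n \<zeta>" for n \<zeta>
    unfolding Q_def by (intro integral_nonneg_AE) (auto simp: pkernel_bounds r)
  have Q1: "AE \<zeta> in circle_measure. Q n \<zeta> \<le> 1" for n
    using AE_circle_norm unfolding Q_def
    by eventually_elim (intro integral_indicator_pkernel_le_1 r; simp)
  have Qi: "integrable circle_measure (Q n)" for n
    by (rule integrable_bounded_circle[where B = 1]) (use Q0 Q1[of n] in auto)
  have iU: "integrable circle_measure (\<lambda>\<zeta>. indicator U \<zeta> :: real)"
    by (rule integrable_bounded_circle[where B = 1]) (auto simp: indicator_def)
  have iV: "integrable circle_measure (\<lambda>\<zeta>. indicator U \<zeta> * (1 - Q n \<zeta>))" for n
    by (rule integrable_bounded_circle[where B = 1])
       (use Q0 Q1[of n] in \<open>auto simp: indicator_def elim!: eventually_mono\<close>)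
  have int_Q: "integral\<^sup>L circle_measure (Q n) = (LINT \<zeta>|circle_measure. indicator U \<zeta>)" for n
  proof -
    have "integral\<^sup>L circle_measure (Q n) =
       (LINT \<xi>|circle_measure. LINT \<zeta>|circle_measure. indicator U \<xi> * pkernel (r n) \<zeta> \<xi>)"
      unfolding Q_def
      by (intro circle_pair.Fubini_integral[symmetric] integrable_circle_pair[where B = "(1 - (r n)\<^sup>2) / (1 - r n)\<^sup>2"])
         (use pkernel_bounds[OF r(1,2), of n] order_trans[OF pkernel_bounds[OF r(1,2), of n]]
            in \<open>auto simp: indicator_def\<close>)
    also have "\<dots> = (LINT \<xi>|circle_measure. indicator U \<xi> * (LINT \<zeta>|circle_measure. pkernel (r n) \<xi> \<zeta>))"
      by (simp add: pkernel_commute)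
    also have "\<dots> = (LINT \<xi>|circle_measure. indicator U \<xi>)"
      by (rule integral_cong_AE)
         (use AE_circle_norm in \<open>auto simp: integral_pkernel r elim!: eventually_mono\<close>)
    finally show ?thesis .
  qed
  have "(LINT \<zeta>|circle_measure. \<bar>Q n \<zeta> - indicator U \<zeta>\<bar>) =
        2 * (LINT \<zeta>|circle_measure. indicator U \<zeta> * (1 - Q n \<zeta>))" for n
  proof -
    \<comment> \<open>Check separately on and off \<open>U\<close>, using that \<open>Q n\<close>
      lies in [0, 1]; the last bracket has integral 0 by \<open>int_Q\<close>.\<close>
    have "(LINT \<zeta>|circle_measure. \<bar>Q n \<zeta> - indicator U \<zeta>\<bar>) =
       (LINT \<zeta>|circle_measure. 2 * (indicator U \<zeta> * (1 - Q n \<zeta>)) + (Q n \<zeta> - indicator U \<zeta>))"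
      by (rule integral_cong_AE)
         (use Q0 Q1[of n] in \<open>auto simp: indicator_def abs_if not_less[symmetric] elim!: eventually_mono\<close>)
    also have "\<dots> = 2 * (LINT \<zeta>|circle_measure. indicator U \<zeta> * (1 - Q n \<zeta>))
        + ((LINT \<zeta>|circle_measure. Q n \<zeta>) - (LINT \<zeta>|circle_measure. indicator U \<zeta>))"
      by (subst Bochner_Integration.integral_add[OF integrable_mult_right[OF iV] Bochner_Integration.integrable_diff[OF Qi iU]])
         (simp only: Bochner_Integration.integral_diff[OF Qi iU] integral_mult_right_zero)
    finally show ?thesis using int_Q[of n] by simp
  qed
  moreover have "(\<lambda>n. LINT \<zeta>|circle_measure. indicator U \<zeta> * (1 - Q n \<zeta>)) \<longlonglongrightarrow> (LINT \<zeta>|circle_measure. 0)"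
  proof (rule integral_dominated_convergence[where w = "\<lambda>_. 1"])
    show "AE \<zeta> in circle_measure. (\<lambda>n. indicator U \<zeta> * (1 - Q n \<zeta>)) \<longlonglongrightarrow> 0"
      using AE_circle_norm
    proof eventually_elim
      case (elim \<zeta>)
      show ?case
      proof (cases "\<zeta> \<in> U")
        case True
        then have "(\<lambda>n. 1 - Q n \<zeta>) \<longlonglongrightarrow> 1 - 1"
          unfolding Q_def using elim by (intro tendsto_intros pkernel_open_tendsto_1 r U)
        then show ?thesis using True by simp
      qed simp
    qed
    show "AE \<zeta> in circle_measure. norm (indicator U \<zeta> * (1 - Q n \<zeta>)) \<le> 1" for n
      using Q1[of n] by eventually_elim (use Q0 in \<open>auto simp: indicator_def\<close>)
  qed auto
  ultimately show ?thesis using tendsto_mult_left[of _ 0 _ 2] by simp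
qed

text \<open>Supplies the passage from open to Borel sets, both for weak-star convergence and for
  covering the null set that carries a singular measure.\<close>

lemma outer_regular_circle:
  assumes "A \<in> sets borel" "e > 0"
  obtains U where "open U" "A \<subseteq> U" "emeasure circle_measure (U - A) < ennreal e"
proof -
  have *: "emeasure circle_measure A = (INF U\<in>{U. A \<subseteq> U \<and> open U}. emeasure circle_measure U)"
    by (rule outer_regular) (use assms in \<open>auto simp: circle.emeasure_space_1[simplified]\<close>)
  have "emeasure circle_measure A < ennreal (measure circle_measure A + e)"
    using assms by (simp add: circle.emeasure_eq_measure ennreal_less_iff)
  then obtain U where U: "A \<subseteq> U" "open U" "emeasure circle_measure U < ennreal (measure circle_measure A + e)"
    unfolding * by (auto simp: INF_less_iff)
  have "measure circle_measure (U - A) = measure circle_measure U - measure circle_measure A"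
    using U assms by (intro circle.finite_measure_Diff) auto
  also have "\<dots> < e"
    using U by (simp add: circle.emeasure_eq_measure ennreal_less_iff)
  finally have "emeasure circle_measure (U - A) < ennreal e"
    by (simp add: circle.emeasure_eq_measure ennreal_less_iff)
  then show ?thesis using U that by blast
qed

text \<open>Symmetry of the kernel moves the averaging from \<Phi> to the test function. For
  indicators of open sets the L1 convergence above applies; outer regularity extends this to Borel
  sets, and density of simple functions to all integrable \<open>f\<close>, because the averages
  \<open>A n\<close> stay bounded by \<open>M\<close>.\<close>

lemma pkernel_weak_star:
  fixes \<Phi> f :: "complex \<Rightarrow> complex"
  assumes r: "\<And>n. 0 \<le> r n" "\<And>n. r n < 1" "r \<longlonglongrightarrow> 1"
    and Phm [measurable]: "\<Phi> \<in> borel_measurable borel" and M: "\<And>z. cmod (\<Phi> z) \<le> M"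
    and f: "integrable circle_measure f"
  shows "(\<lambda>n. LINT \<zeta>|circle_measure.
            (LINT \<xi>|circle_measure. \<Phi> \<xi> * of_real (pkernel (r n) \<zeta> \<xi>)) * f \<zeta>)
         \<longlonglongrightarrow> (LINT z|circle_measure. \<Phi> z * f z)"
proof -
  define A where "A = (\<lambda>n \<zeta>. LINT \<xi>|circle_measure. \<Phi> \<xi> * complex_of_real (pkernel (r n) \<zeta> \<xi>))"
  have Am [measurable]: "A n \<in> borel_measurable borel" for n unfolding A_def by measurable
  have M0: "0 \<le> M" using M[of 0] norm_ge_zero order_trans by blast
  have AM: "AE \<zeta> in circle_measure. cmod (A n \<zeta>) \<le> M" for n
    using AE_circle_norm
  proof eventually_elim
    case (elim \<zeta>)
    have "A n \<zeta> = (LINT \<xi>|circle_measure. \<Phi> \<xi> * of_real (poisson (of_real (r n) * \<zeta>) \<xi>))"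
      unfolding A_def
      by (rule integral_cong_AE) (use AE_pkernel_eq_poisson[OF r(1,2) elim, of n] in auto)
    then show ?case
      using norm_integral_poisson_le[of "of_real (r n) * \<zeta>" \<Phi> M] M elim r by (simp add: norm_mult)
  qed
  have int_mult: "integrable circle_measure (\<lambda>z. G z * g z)"
    and norm_mult_le: "cmod (LINT z|circle_measure. G z * g z) \<le> M * (LINT z|circle_measure. cmod (g z))"
    if g: "integrable circle_measure g" and [measurable]: "G \<in> borel_measurable borel"
      and G: "AE z in circle_measure. cmod (G z) \<le> M" for g G :: "complex \<Rightarrow> complex"
  proof -
    show i: "integrable circle_measure (\<lambda>z. G z * g z)"
      using integrable_mult_bounded[OF g _ G] by (simp add: mult.commute)
    have "cmod (LINT z|circle_measure. G z * g z) \<le> (LINT z|circle_measure. cmod (G z * g z))"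
      by (rule integral_norm_bound)
    also have "\<dots> \<le> (LINT z|circle_measure. M * cmod (g z))"
    proof (rule integral_mono_AE)
      show "AE z in circle_measure. cmod (G z * g z) \<le> M * cmod (g z)"
        using G by eventually_elim (simp add: norm_mult mult_right_mono)
    qed (use i g in auto)
    finally show "cmod (LINT z|circle_measure. G z * g z) \<le> M * (LINT z|circle_measure. cmod (g z))"
      by simp
  qed
  have PhiM: "AE z in circle_measure. cmod (\<Phi> z) \<le> M" using M by simp
  define conv where "conv = (\<lambda>g. (\<lambda>n. LINT \<zeta>|circle_measure. A n \<zeta> * g \<zeta>)
         \<longlonglongrightarrow> (LINT z|circle_measure. \<Phi> z * g z))"
  \<comment> \<open>The good test functions are closed in L1, since pairing with \<Phi> or with
    \<open>A n\<close> has norm at most \<open>M\<close>.\<close>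
  have approx: "conv g" if g: "integrable circle_measure g"
    and ap: "\<And>e. e > 0 \<Longrightarrow> \<exists>h. integrable circle_measure h \<and> conv h \<and> (LINT z|circle_measure. cmod (g z - h z)) \<le> e"
    for g
    unfolding conv_def
  proof (rule LIMSEQ_I)
    fix e :: real assume e: "e > 0"
    \<comment> \<open>Each of the two errors from replacing \<open>g\<close> by \<open>h\<close>
      costs at most \<open>e / 4\<close>, leaving \<open>e / 2\<close> for \<open>h\<close> itself;
      the added 1 keeps the denominator positive when \<open>M = 0\<close>.\<close>
    define d where "d = e / (4 * (M + 1))"
    have d: "d > 0" "M * d < e / 4"
      using e M0 by (auto simp: d_def field_simps)
    obtain h where h: "integrable circle_measure h" "conv h" "(LINT z|circle_measure. cmod (g z - h z)) \<le> d"
      using ap[OF d(1)] by auto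
    have gh: "integrable circle_measure (\<lambda>z. g z - h z)" using g h by auto
    have sm: "cmod (LINT z|circle_measure. G z * (g z - h z)) \<le> e / 4"
      if "G \<in> borel_measurable borel" "AE z in circle_measure. cmod (G z) \<le> M" for G
      using norm_mult_le[OF gh that] mult_left_mono[OF h(3) M0] d by linarith
    obtain N where N: "\<And>n. n \<ge> N \<Longrightarrow> cmod ((LINT \<zeta>|circle_measure. A n \<zeta> * h \<zeta>) - (LINT z|circle_measure. \<Phi> z * h z)) < e / 2"
      using LIMSEQ_D[OF h(2)[unfolded conv_def], of "e/2"] e by auto
    show "\<exists>N. \<forall>n\<ge>N. cmod ((LINT \<zeta>|circle_measure. A n \<zeta> * g \<zeta>) - (LINT z|circle_measure. \<Phi> z * g z)) < e"
    proof (intro exI allI impI)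
      fix n assume "n \<ge> N"
      have split: "(LINT z|circle_measure. G z * g z) = (LINT z|circle_measure. G z * h z) + (LINT z|circle_measure. G z * (g z - h z))"
        if "G \<in> borel_measurable borel" "AE z in circle_measure. cmod (G z) \<le> M" for G
        by (subst Bochner_Integration.integral_add[symmetric])
           (use int_mult[OF h(1) that] int_mult[OF gh that] in \<open>auto simp: algebra_simps\<close>)
      have dec: "(LINT \<zeta>|circle_measure. A n \<zeta> * g \<zeta>) - (LINT z|circle_measure. \<Phi> z * g z)
         = ((LINT \<zeta>|circle_measure. A n \<zeta> * h \<zeta>) - (LINT z|circle_measure. \<Phi> z * h z))
           + (LINT z|circle_measure. A n z * (g z - h z)) - (LINT z|circle_measure. \<Phi> z * (g z - h z))"
        using split[OF Am AM] split[OF Phm PhiM] by simp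
      have "cmod ((LINT \<zeta>|circle_measure. A n \<zeta> * g \<zeta>) - (LINT z|circle_measure. \<Phi> z * g z))
         \<le> cmod ((LINT \<zeta>|circle_measure. A n \<zeta> * h \<zeta>) - (LINT z|circle_measure. \<Phi> z * h z))
          + cmod (LINT z|circle_measure. A n z * (g z - h z)) + cmod (LINT z|circle_measure. \<Phi> z * (g z - h z))"
        unfolding dec by (intro order_trans[OF norm_triangle_ineq4] add_right_mono norm_triangle_ineq)
      also have "\<dots> < e / 2 + e / 4 + e / 4"
        using N[OF \<open>n \<ge> N\<close>] sm[OF Am AM, of n] sm[OF Phm PhiM] by (intro add_less_le_mono)
      also have "\<dots> = e" by simp
      finally show "cmod ((LINT \<zeta>|circle_measure. A n \<zeta> * g \<zeta>) - (LINT z|circle_measure. \<Phi> z * g z)) < e" .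
    qed
  qed
  have conv_open: "conv (indicator U)" if U: "open U" for U
  proof -
    have [measurable]: "U \<in> sets borel" using U by auto
    define Q where "Q = (\<lambda>n \<zeta>. LINT \<xi>|circle_measure. indicator U \<xi> * pkernel (r n) \<zeta> \<xi>)"
    have [measurable]: "Q n \<in> borel_measurable borel" for n unfolding Q_def by measurable
    \<comment> \<open>Fubini and the symmetry of the kernel transfer the averaging to the indicator,
      where \<open>pkernel_open_tendsto_L1\<close> is available.\<close>
    have eq: "(LINT \<zeta>|circle_measure. A n \<zeta> * indicator U \<zeta>) = (LINT \<xi>|circle_measure. \<Phi> \<xi> * of_real (Q n \<xi>))" for n
    proof -
      have "(LINT \<zeta>|circle_measure. A n \<zeta> * indicator U \<zeta>) =
        (LINT \<zeta>|circle_measure. LINT \<xi>|circle_measure. \<Phi> \<xi> * of_real (pkernel (r n) \<zeta> \<xi>) * indicator U \<zeta>)"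
        unfolding A_def by simp
      also have "\<dots> = (LINT \<xi>|circle_measure. LINT \<zeta>|circle_measure. \<Phi> \<xi> * of_real (pkernel (r n) \<zeta> \<xi>) * indicator U \<zeta>)"
      proof (intro circle_pair.Fubini_integral[symmetric] integrable_circle_pair[where B = "M * ((1 - (r n)\<^sup>2) / (1 - r n)\<^sup>2)"])
        show "norm (\<Phi> \<xi> * complex_of_real (pkernel (r n) \<zeta> \<xi>) * indicator U \<zeta>)
            \<le> M * ((1 - (r n)\<^sup>2) / (1 - r n)\<^sup>2)" for \<zeta> \<xi>
        proof -
          have "norm (\<Phi> \<xi> * complex_of_real (pkernel (r n) \<zeta> \<xi>) * indicator U \<zeta>)
             \<le> norm (\<Phi> \<xi>) * norm (complex_of_real (pkernel (r n) \<zeta> \<xi>))"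
            by (auto simp: norm_mult indicator_def)
          also have "\<dots> \<le> M * ((1 - (r n)\<^sup>2) / (1 - r n)\<^sup>2)"
            using pkernel_bounds[OF r(1,2)] M M0 by (intro mult_mono) auto
          finally show ?thesis .
        qed
      qed measurable
      also have "\<dots> = (LINT \<xi>|circle_measure. \<Phi> \<xi> * of_real (Q n \<xi>))"
      proof (rule Bochner_Integration.integral_cong[OF refl])
        fix \<xi>
        have "(LINT \<zeta>|circle_measure. \<Phi> \<xi> * of_real (pkernel (r n) \<zeta> \<xi>) * indicator U \<zeta>) =
              (LINT \<zeta>|circle_measure. \<Phi> \<xi> * of_real (indicator U \<zeta> * pkernel (r n) \<xi> \<zeta>))"
          by (intro Bochner_Integration.integral_cong refl) (auto simp: indicator_def pkernel_commute[of _ _ \<xi>])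
        also have "\<dots> = \<Phi> \<xi> * of_real (Q n \<xi>)"
          unfolding Q_def integral_complex_of_real[symmetric] by (rule integral_mult_right_zero)
        finally show "(LINT \<zeta>|circle_measure. \<Phi> \<xi> * of_real (pkernel (r n) \<zeta> \<xi>) * indicator U \<zeta>) = \<Phi> \<xi> * of_real (Q n \<xi>)" .
      qed
      finally show ?thesis .
    qed
    have Qi: "integrable circle_measure (\<lambda>z. complex_of_real (Q n z))" for n
    proof (rule integrable_bounded_circle[where B = 1])
      show "AE z in circle_measure. norm (complex_of_real (Q n z)) \<le> 1"
        using AE_circle_norm
      proof eventually_elim
        case (elim z)
        have "0 \<le> Q n z" unfolding Q_def by (intro integral_nonneg_AE) (auto simp: pkernel_bounds r)
        moreover have "Q n z \<le> 1" unfolding Q_def using elim by (intro integral_indicator_pkernel_le_1 r) auto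
        ultimately show ?case by simp
      qed
    qed measurable
    have Ui: "integrable circle_measure (indicator U :: complex \<Rightarrow> complex)"
      by (rule integrable_bounded_circle[where B = 1]) (auto simp: indicator_def)
    have bd: "cmod ((LINT \<zeta>|circle_measure. A n \<zeta> * indicator U \<zeta>) - (LINT z|circle_measure. \<Phi> z * indicator U z))
       \<le> M * (LINT \<zeta>|circle_measure. \<bar>Q n \<zeta> - indicator U \<zeta>\<bar>)" for n
    proof -
      have dec: "(LINT \<zeta>|circle_measure. A n \<zeta> * indicator U \<zeta>) - (LINT z|circle_measure. \<Phi> z * indicator U z)
        = (LINT z|circle_measure. \<Phi> z * (of_real (Q n z) - indicator U z))"
        unfolding eq
        by (subst Bochner_Integration.integral_diff[symmetric])
           (use int_mult[OF Qi Phm PhiM] int_mult[OF Ui Phm PhiM] in \<open>auto simp: algebra_simps\<close>)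
      have "cmod (LINT z|circle_measure. \<Phi> z * (of_real (Q n z) - indicator U z))
          \<le> M * (LINT z|circle_measure. cmod (of_real (Q n z) - indicator U z))"
        using Qi Ui by (intro norm_mult_le PhiM) auto
      also have "(LINT z|circle_measure. cmod (of_real (Q n z) - indicator U z)) =
          (LINT \<zeta>|circle_measure. \<bar>Q n \<zeta> - indicator U \<zeta>\<bar>)"
      proof (rule Bochner_Integration.integral_cong[OF refl])
        fix z
        have "complex_of_real (Q n z) - indicator U z = of_real (Q n z - indicator U z)"
          by (auto simp: indicator_def)
        then show "cmod (of_real (Q n z) - indicator U z) = \<bar>Q n z - indicator U z\<bar>"
          by (simp only: norm_of_real)
      qed
      finally show ?thesis unfolding dec .
    qed
    have "(\<lambda>n. M * (LINT \<zeta>|circle_measure. \<bar>Q n \<zeta> - indicator U \<zeta>\<bar>)) \<longlonglongrightarrow> M * 0"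
      unfolding Q_def by (intro tendsto_intros pkernel_open_tendsto_L1 r U)
    then have M0: "(\<lambda>n. M * (LINT \<zeta>|circle_measure. \<bar>Q n \<zeta> - indicator U \<zeta>\<bar>)) \<longlonglongrightarrow> 0"
      by (simp only: mult_zero_right)
    have "(\<lambda>n. (LINT \<zeta>|circle_measure. A n \<zeta> * indicator U \<zeta>) - (LINT z|circle_measure. \<Phi> z * indicator U z)) \<longlonglongrightarrow> 0"
      by (rule Lim_null_comparison[OF always_eventually M0]) (intro allI bd)
    then show ?thesis unfolding conv_def by (rule LIM_zero_cancel)
  qed
  have conv_set: "conv (indicator S)" if S [measurable]: "S \<in> sets borel" for S
  proof (rule approx)
    show "integrable circle_measure (indicator S :: complex \<Rightarrow> complex)"
      by (rule integrable_bounded_circle[where B = 1]) (auto simp: indicator_def)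
    fix e :: real assume e: "e > 0"
    obtain U where U: "open U" "S \<subseteq> U" "emeasure circle_measure (U - S) < ennreal e"
      using outer_regular_circle[OF S e] .
    have [measurable]: "U \<in> sets borel" using U by auto
    have "(LINT z|circle_measure. cmod (indicator S z - indicator U z)) = (LINT z|circle_measure. indicator (U - S) z)"
      using U by (intro Bochner_Integration.integral_cong) (auto simp: indicator_def)
    also have "\<dots> \<le> e"
      using U e by (simp add: circle.emeasure_eq_measure ennreal_less_iff less_imp_le)
    finally have "(LINT z|circle_measure. cmod (indicator S z - indicator U z)) \<le> e" .
    moreover have "integrable circle_measure (indicator U :: complex \<Rightarrow> complex)"
      by (rule integrable_bounded_circle[where B = 1]) (auto simp: indicator_def)
    ultimately show "\<exists>h. integrable circle_measure h \<and> conv h \<and> (LINT z|circle_measure. cmod (indicator S z - h z)) \<le> e"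
      using conv_open[OF U(1)] by blast
  qed
  have "conv f"
    using f
  proof (induction rule: integrable_induct)
    case (base S c)
    then have "S \<in> sets borel" by simp
    from tendsto_mult_right[OF conv_set[OF this, unfolded conv_def], of c]
    have "(\<lambda>n. LINT z|circle_measure. A n z * indicator S z * c) \<longlonglongrightarrow> (LINT z|circle_measure. \<Phi> z * indicator S z * c)"
      by simp
    moreover have "G z * indicator S z * c = G z * (indicator S z *\<^sub>R c)" for G :: "complex \<Rightarrow> complex" and z
      by (auto simp: indicator_def)
    ultimately show ?case unfolding conv_def by simp
  next
    case (add f g)
    have "(LINT z|circle_measure. G z * (f z + g z)) = (LINT z|circle_measure. G z * f z) + (LINT z|circle_measure. G z * g z)"
        if "G \<in> borel_measurable borel" "AE z in circle_measure. cmod (G z) \<le> M" for G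
        by (subst Bochner_Integration.integral_add[symmetric])
           (auto intro: int_mult[OF add(1) that] int_mult[OF add(2) that] simp: distrib_left)
    from this[OF Am AM] this[OF Phm PhiM] show ?case
      using tendsto_add[OF add(3,4)[unfolded conv_def]] unfolding conv_def by (simp only:)
  next
    case (lim f s)
    show ?case
    proof (rule approx[OF lim(4)])
      fix e :: real assume e: "e > 0"
      have [measurable]: "f \<in> borel_measurable borel" "s i \<in> borel_measurable borel" for i
        using lim by auto
      have "(\<lambda>i. LINT z|circle_measure. cmod (f z - s i z)) \<longlonglongrightarrow> (LINT z|circle_measure. 0)"
      \<comment> \<open>The induction rule supplies approximants with norm at most twice that of
        \<open>f\<close>; the triangle inequality makes it three times.\<close>
      proof (rule integral_dominated_convergence[where w = "\<lambda>z. 3 * cmod (f z)"])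
        show "AE z in circle_measure. (\<lambda>i. cmod (f z - s i z)) \<longlonglongrightarrow> 0"
        proof (intro AE_I2)
          fix z
          have "(\<lambda>i. cmod (f z - s i z)) \<longlonglongrightarrow> cmod (f z - f z)"
            by (intro tendsto_intros lim(2)) simp
          then show "(\<lambda>i. cmod (f z - s i z)) \<longlonglongrightarrow> 0" by simp
        qed
        show "AE z in circle_measure. norm (cmod (f z - s i z)) \<le> 3 * cmod (f z)" for i
        proof (intro AE_I2)
          fix z
          show "norm (cmod (f z - s i z)) \<le> 3 * cmod (f z)"
            using norm_triangle_ineq4[of "f z" "s i z"] lim(3)[of z i] by simp
        qed
      qed (use lim in auto)
      then have "eventually (\<lambda>i. (LINT z|circle_measure. cmod (f z - s i z)) < e) sequentially"
        using order_tendstoD(2)[of _ 0 _ e] e by simp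
      then obtain i where "(LINT z|circle_measure. cmod (f z - s i z)) < e"
        by (auto simp: eventually_sequentially)
      then show "\<exists>h. integrable circle_measure h \<and> conv h \<and> (LINT z|circle_measure. cmod (f z - h z)) \<le> e"
        using lim(1,5) by (intro exI[of _ "s i"]) auto
    qed
  qed
  then show ?thesis unfolding conv_def A_def .
qed

section \<open>Pairings of Hardy functions\<close>

text \<open>Expand the extension of \<Phi> at \<open>r * z\<close> in powers of \<open>z\<close>.
  The factor \<open>r ^ k\<close> makes the series absolutely summable after multiplication by
  \<open>G\<close>, so it can be integrated termwise, and the moments of \<open>G\<close> turn it
  into the power series at \<open>r * l\<close>.\<close>

lemma radial_pairing:
  assumes Phi: "\<Phi> \<in> H1" and r: "0 \<le> r" "r < 1" and l: "cmod l < 1"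
    and G: "integrable circle_measure G"
    and mom: "\<And>k. (LINT z|circle_measure. G z * z ^ k) = l ^ k * c"
  shows "(LINT z|circle_measure. disc_ext \<Phi> (of_real r * z) * G z) = disc_ext \<Phi> (of_real r * l) * c"
proof -
  have Phii: "integrable circle_measure \<Phi>" using Phi by (simp add: H1_def)
  have [measurable]: "\<Phi> \<in> borel_measurable borel" "G \<in> borel_measurable borel"
    using Phii G by auto
  \<comment> \<open>These are the Taylor coefficients of \<open>disc_ext \<Phi>\<close>; all are
    bounded by the L1 norm \<open>B\<close> of \<Phi>.\<close>
  define a where "a = (\<lambda>k. LINT z|circle_measure. \<Phi> z * cnj z ^ k)"
  define B where "B = (LINT z|circle_measure. cmod (\<Phi> z))"
  have aB: "cmod (a k) \<le> B" for k
  proof -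
    have "cmod (a k) \<le> (LINT z|circle_measure. cmod (\<Phi> z * cnj z ^ k))"
      unfolding a_def by (rule integral_norm_bound)
    also have "\<dots> = B" unfolding B_def
      by (rule integral_cong_AE)
         (use AE_circle_norm in \<open>auto simp: norm_mult norm_power elim!: eventually_mono\<close>)
    finally show ?thesis .
  qed
  have ser: "(\<lambda>k. w ^ k * a k) sums disc_ext \<Phi> w" if "cmod w < 1" for w
    unfolding a_def disc_ext_def using that
    by (intro geometric_sums_circle Phii) (auto simp: AE_circle_norm)
  define f where "f = (\<lambda>k z. of_real r ^ k * a k * (G z * z ^ k))"
  have fi: "integrable circle_measure (f k)" for k
    unfolding f_def by (intro integrable_mult_right integrable_mult_power G)
  have fn: "AE z in circle_measure. \<forall>k. norm (f k z) = cmod (a k) * cmod (G z) * r ^ k"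
    using AE_circle_norm
    by eventually_elim (use r in \<open>simp add: f_def norm_mult norm_power\<close>)
  have fle: "cmod (a k) * x * r ^ k \<le> B * x * r ^ k" if "x \<ge> 0" for k x
    using aB[of k] r that by (intro mult_right_mono) auto
  have "(\<lambda>k. LINT z|circle_measure. f k z) sums (LINT z|circle_measure. (\<Sum>k. f k z))"
  proof (rule sums_integral[OF fi])
    show "AE z in circle_measure. summable (\<lambda>k. norm (f k z))"
      using fn
    proof eventually_elim
      case (elim z)
      have "summable (\<lambda>k. B * cmod (G z) * r ^ k)"
        using r by (intro summable_mult summable_geometric) auto
      then show ?case
        by (rule summable_comparison_test') (use elim fle[of "cmod (G z)"] r in \<open>simp add: abs_mult\<close>)
    qed
    have eq: "(LINT z|circle_measure. norm (f k z)) = cmod (a k) * (LINT z|circle_measure. cmod (G z)) * r ^ k" for k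
    proof -
      have "(LINT z|circle_measure. norm (f k z)) = (LINT z|circle_measure. (cmod (a k) * r ^ k) * cmod (G z))"
        by (rule integral_cong_AE) (use fn in \<open>auto simp: f_def mult_ac elim!: eventually_mono\<close>)
      then show ?thesis by (simp add: mult_ac)
    qed
    have "summable (\<lambda>k. B * (LINT z|circle_measure. cmod (G z)) * r ^ k)"
      using r by (intro summable_mult summable_geometric) auto
    then show "summable (\<lambda>k. LINT z|circle_measure. norm (f k z))"
      by (rule summable_comparison_test')
         (use fle[of "LINT z|circle_measure. cmod (G z)"] r in \<open>simp add: eq\<close>)
  qed
  also have "(LINT z|circle_measure. (\<Sum>k. f k z)) = (LINT z|circle_measure. disc_ext \<Phi> (of_real r * z) * G z)"
  proof (rule integral_cong_AE)
    show "AE z in circle_measure. (\<Sum>k. f k z) = disc_ext \<Phi> (of_real r * z) * G z"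
      using AE_circle_norm
    proof eventually_elim
      case (elim z)
      then have "cmod (of_real r * z) < 1" using r by (simp add: norm_mult)
      from sums_mult2[OF ser[OF this], of "G z"]
      have "(\<lambda>k. f k z) sums (disc_ext \<Phi> (of_real r * z) * G z)"
        by (simp add: f_def power_mult_distrib mult_ac)
      then show ?case by (rule sums_unique[symmetric])
    qed
    show "(\<lambda>z. disc_ext \<Phi> (of_real r * z) * G z) \<in> borel_measurable circle_measure"
      unfolding disc_ext_def by measurable
  qed (auto simp: f_def)
  finally have s1: "(\<lambda>k. LINT z|circle_measure. f k z) sums (LINT z|circle_measure. disc_ext \<Phi> (of_real r * z) * G z)" .
  have "r * cmod l < 1"
    using r l by (metis mult_le_one norm_ge_zero mult_left_le less_imp_le mult.commute le_less_trans)
  then have "cmod (of_real r * l) < 1" using r by (simp add: norm_mult)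
  have "(LINT z|circle_measure. f k z) = of_real r ^ k * a k * (l ^ k * c)" for k
    unfolding f_def integral_mult_right_zero mom ..
  with sums_mult2[OF ser[OF \<open>cmod (of_real r * l) < 1\<close>], of c]
  have "(\<lambda>k. LINT z|circle_measure. f k z) sums (disc_ext \<Phi> (of_real r * l) * c)"
    by (simp add: power_mult_distrib mult_ac)
  with s1 show ?thesis by (rule sums_unique2)
qed

text \<open>Formally the pairing is \<open>c\<close> times the value of \<Phi> at \<open>l\<close>.
  It is obtained as the limit of the pairings with the dilates of \<Phi>, which are Poisson means
  and converge weak-star; each such pairing is \<open>c\<close> times a value of the extension in
  the disc, and these values are bounded by \<open>M\<close>.\<close>

lemma hardy_pairing_bound:
  assumes Phi: "\<Phi> \<in> H1" and M: "AE z in circle_measure. cmod (\<Phi> z) \<le> M" and l: "cmod l < 1"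
    and G: "integrable circle_measure G"
    and mom: "\<And>k. (LINT z|circle_measure. G z * z ^ k) = l ^ k * c"
  shows "cmod (LINT z|circle_measure. \<Phi> z * G z) \<le> M * cmod c"
proof -
  have [measurable]: "\<Phi> \<in> borel_measurable borel" "G \<in> borel_measurable borel"
    using Phi G by (auto simp: H1_def)
  \<comment> \<open>\<open>pkernel_weak_star\<close> asks for a bound at every point; truncation
    provides it and changes \<Phi> only on a null set.\<close>
  define \<Psi> where "\<Psi> = (\<lambda>z. if cmod (\<Phi> z) \<le> M then \<Phi> z else 0)"
  have Psi: "AE z in circle_measure. \<Psi> z = \<Phi> z" using M by eventually_elim (simp add: \<Psi>_def)
  have [measurable]: "\<Psi> \<in> borel_measurable borel" unfolding \<Psi>_def by measurable
  define r where "r = (\<lambda>n. real n / real (Suc n))"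
  have r: "0 \<le> r n" "r n < 1" for n by (auto simp: r_def)
  have r1: "r \<longlonglongrightarrow> 1" unfolding r_def by (rule LIMSEQ_n_over_Suc_n)
  have "(\<lambda>n. LINT \<zeta>|circle_measure.
            (LINT \<xi>|circle_measure. \<Psi> \<xi> * of_real (pkernel (r n) \<zeta> \<xi>)) * G \<zeta>)
         \<longlonglongrightarrow> (LINT z|circle_measure. \<Psi> z * G z)"
    by (rule pkernel_weak_star[OF r r1 _ _ G, where M = "\<bar>M\<bar>"]) (auto simp: \<Psi>_def)
  moreover have "(LINT \<zeta>|circle_measure. (LINT \<xi>|circle_measure. \<Psi> \<xi> * of_real (pkernel (r n) \<zeta> \<xi>)) * G \<zeta>)
     = disc_ext \<Phi> (of_real (r n) * l) * c" for n
  proof -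
    have "(LINT \<zeta>|circle_measure. (LINT \<xi>|circle_measure. \<Psi> \<xi> * of_real (pkernel (r n) \<zeta> \<xi>)) * G \<zeta>)
       = (LINT z|circle_measure. disc_ext \<Phi> (of_real (r n) * z) * G z)"
    proof (rule integral_cong_AE)
      show "AE z in circle_measure. (LINT \<xi>|circle_measure. \<Psi> \<xi> * of_real (pkernel (r n) z \<xi>)) * G z
          = disc_ext \<Phi> (of_real (r n) * z) * G z"
        using AE_circle_norm
      proof eventually_elim
        case (elim z)
        have "(LINT \<xi>|circle_measure. \<Psi> \<xi> * of_real (pkernel (r n) z \<xi>)) =
              (LINT \<xi>|circle_measure. \<Phi> \<xi> * of_real (poisson (of_real (r n) * z) \<xi>))"
        proof (rule integral_cong_AE)
          show "AE \<xi> in circle_measure. \<Psi> \<xi> * complex_of_real (pkernel (r n) z \<xi>) =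
              \<Phi> \<xi> * complex_of_real (poisson (of_real (r n) * z) \<xi>)"
            using AE_pkernel_eq_poisson[OF r[of n] elim] Psi by eventually_elim simp
        qed auto
        \<comment> \<open>The case \<open>k = 0\<close> of \<open>poisson_moment\<close> identifies
          the Poisson mean with the Cauchy integral.\<close>
        also have "\<dots> = disc_ext \<Phi> (of_real (r n) * z)"
          using poisson_moment[OF Phi, of "of_real (r n) * z" 0] r[of n] elim by (simp add: norm_mult)
        finally show ?case by simp
      qed
      show "(\<lambda>z. disc_ext \<Phi> (of_real (r n) * z) * G z) \<in> borel_measurable circle_measure"
        unfolding disc_ext_def by measurable
    qed measurable
    also have "\<dots> = disc_ext \<Phi> (of_real (r n) * l) * c"
      by (rule radial_pairing[OF Phi r l G mom])
    finally show ?thesis .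
  qed
  moreover have "(LINT z|circle_measure. \<Psi> z * G z) = (LINT z|circle_measure. \<Phi> z * G z)"
    by (rule integral_cong_AE) (use Psi in \<open>auto elim!: eventually_mono\<close>)
  ultimately have "(\<lambda>n. disc_ext \<Phi> (of_real (r n) * l) * c) \<longlonglongrightarrow> (LINT z|circle_measure. \<Phi> z * G z)"
    by simp
  from tendsto_norm[OF this] show ?thesis
  proof (rule LIMSEQ_le_const2, intro exI allI impI)
    fix n :: nat
    have "r n * cmod l \<le> 1 * cmod l" using r[of n] by (intro mult_right_mono) auto
    then have w: "cmod (of_real (r n) * l) < 1" using r[of n] l by (simp add: norm_mult)
    have "disc_ext \<Phi> (of_real (r n) * l) = (LINT z|circle_measure. \<Phi> z * of_real (poisson (of_real (r n) * l) z))"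
      using poisson_moment[OF Phi w, of 0] by simp
    then have "cmod (disc_ext \<Phi> (of_real (r n) * l)) \<le> M"
      using norm_integral_poisson_le[OF w _ M] by simp
    then show "cmod (disc_ext \<Phi> (of_real (r n) * l) * c) \<le> M * cmod c"
      by (simp add: norm_mult mult_right_mono)
  qed
qed

text \<open>Pair \<Phi> with \<open>I\<close> times the Cauchy kernel, whose moments are
  \<open>l ^ k * disc_ext I l\<close>. This yields at once what multiplicativity of the extension
  and the maximum principle would give.\<close>

lemma disc_ext_mult_bound:
  assumes Phi: "\<Phi> \<in> H1" and M: "AE z in circle_measure. cmod (\<Phi> z) \<le> M" and I: "I \<in> H1"
    and \<phi>: "\<phi> \<in> borel_measurable borel" "AE z in circle_measure. \<phi> z = \<Phi> z * I z" and l: "cmod l < 1"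
  shows "cmod (disc_ext \<phi> l) \<le> M * cmod (disc_ext I l)"
proof -
  have Ii: "integrable circle_measure I" using I by (simp add: H1_def)
  have [measurable]: "\<Phi> \<in> borel_measurable borel" "I \<in> borel_measurable borel"
    using Phi I by (auto simp: H1_def)
  have "cmod (LINT z|circle_measure. \<Phi> z * (I z / (1 - l * cnj z))) \<le> M * cmod (disc_ext I l)"
  proof (rule hardy_pairing_bound[OF Phi M l])
    show "integrable circle_measure (\<lambda>z. I z / (1 - l * cnj z))"
      using integrable_cauchy_kernel[OF Ii l, of cnj 0] by (simp add: AE_circle_norm)
    show "(LINT z|circle_measure. I z / (1 - l * cnj z) * z ^ k) = l ^ k * disc_ext I l" for k
      using cauchy_moment[OF I l, of k] by simp
  qed
  also have "(LINT z|circle_measure. \<Phi> z * (I z / (1 - l * cnj z))) = disc_ext \<phi> l"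
    unfolding disc_ext_def
    by (rule integral_cong_AE) (use \<phi> in \<open>auto elim!: eventually_mono\<close>)
  finally show ?thesis .
qed

lemma poisson_duality_bound:
  assumes \<phi>: "\<phi> \<in> H1" and M: "AE z in circle_measure. cmod (\<phi> z) \<le> M"
    and f: "f \<in> H1" and L: "AE z in circle_measure. cmod (f z) \<le> L"
    and N: "AE z in circle_measure. cmod (\<phi> z - cnj (f z)) \<le> N" "0 \<le> N"
    and l: "cmod l < 1"
  defines "p \<equiv> disc_ext \<phi> l"
  shows "(LINT z|circle_measure. (cmod (\<phi> z))\<^sup>2 * poisson l z) - (cmod p)\<^sup>2 \<le> N * (M + cmod p)"
proof -
  have [measurable]: "\<phi> \<in> borel_measurable borel" "f \<in> borel_measurable borel"
    using \<phi> f by (auto simp: H1_def)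
  define P where "P = (\<lambda>z. complex_of_real (poisson l z))"
  have Pm [measurable]: "P \<in> borel_measurable borel" unfolding P_def by measurable
  have Pi: "integrable circle_measure P" unfolding P_def using integrable_poisson[OF l] by simp
  have bP: "integrable circle_measure (\<lambda>z. F z * P z)"
    if "F \<in> borel_measurable borel" "AE z in circle_measure. cmod (F z) \<le> B" for F B
    using integrable_mult_bounded[OF Pi, of F B] that by (simp add: mult.commute)
  \<comment> \<open>Subtracting \<open>p\<close> makes every moment of nonnegative order vanish,
    since those of \<phi> and of 1 against the Poisson kernel are \<open>l ^ k * p\<close> and
    \<open>l ^ k\<close>.\<close>
  define g where "g = (\<lambda>z. (\<phi> z - p) * P z)"
  have [measurable]: "g \<in> borel_measurable borel" unfolding g_def by measurable
  have bd: "AE z in circle_measure. cmod (\<phi> z - p) \<le> M + cmod p"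
    using M by eventually_elim (metis add_right_mono norm_triangle_ineq4 order_trans)
  have gi: "integrable circle_measure g"
    unfolding g_def by (rule bP[OF _ bd]) measurable
  have mom: "(LINT z|circle_measure. g z * z ^ k) = l ^ k * 0" for k
  proof -
    have "(LINT z|circle_measure. g z * z ^ k) = (LINT z|circle_measure. \<phi> z * z ^ k * P z - p * (1 * z ^ k * P z))"
      by (intro Bochner_Integration.integral_cong) (auto simp: g_def algebra_simps)
    also have "\<dots> = (LINT z|circle_measure. \<phi> z * z ^ k * P z) - p * (LINT z|circle_measure. 1 * z ^ k * P z)"
    proof (subst Bochner_Integration.integral_diff)
      show "integrable circle_measure (\<lambda>z. \<phi> z * z ^ k * P z)"
        using integrable_mult_power[OF bP[OF _ M], of k] by (simp add: mult_ac)
      show "integrable circle_measure (\<lambda>z. p * (1 * z ^ k * P z))"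
        using integrable_mult_power[OF Pi, of k] by (intro integrable_mult_right) (simp add: mult_ac)
    qed (simp only: integral_mult_right_zero)
    also have "\<dots> = 0"
      unfolding P_def by (simp only: poisson_moment[OF \<phi> l] poisson_moment[OF one_in_H1 l] disc_ext_one[OF l] p_def) simp
    finally show ?thesis by simp
  qed
  \<comment> \<open>With moment constant \<open>c = 0\<close> the pairing bound says that the
    pairing vanishes exactly.\<close>
  have "cmod (LINT z|circle_measure. f z * g z) \<le> L * cmod 0"
    by (rule hardy_pairing_bound[OF f L l gi mom])
  then have fg: "(LINT z|circle_measure. cnj (f z * g z)) = 0"
    by (simp only: Bochner_Integration.integral_cnj) simp
  have i1: "integrable circle_measure (\<lambda>z. \<phi> z * cnj (g z))"
    using integrable_mult_bounded[OF integrable_cnj[OF gi] _ M] by (simp add: mult.commute)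
  have i2: "integrable circle_measure (\<lambda>z. cnj (f z * g z))"
    using integrable_mult_bounded[OF gi _ L] by (intro integrable_cnj) (simp add: mult.commute)
  have i3: "integrable circle_measure (\<lambda>z. complex_of_real ((cmod (\<phi> z))\<^sup>2 * poisson l z))"
  proof -
    have "AE z in circle_measure. cmod (complex_of_real ((cmod (\<phi> z))\<^sup>2)) \<le> M\<^sup>2"
      using M by eventually_elim (simp add: norm_power power_mono)
    from bP[OF _ this] show ?thesis by (simp add: P_def)
  qed
  have i4: "integrable circle_measure (\<lambda>z. cnj p * (\<phi> z * P z))"
    using bP[OF _ M] by simp
  have "(LINT z|circle_measure. (\<phi> z - cnj (f z)) * cnj (g z)) =
     (LINT z|circle_measure. \<phi> z * cnj (g z)) - (LINT z|circle_measure. cnj (f z * g z))"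
    by (subst Bochner_Integration.integral_diff[symmetric, OF i1 i2]) (simp add: algebra_simps)
  \<comment> \<open>The \<open>f\<close> term is gone, and \<open>P\<close> is real. Since the
    Poisson mean of \<phi> is \<open>p\<close>, the subtracted term becomes the squared modulus of
    \<open>p\<close>.\<close>
  also have "\<dots> = (LINT z|circle_measure. complex_of_real ((cmod (\<phi> z))\<^sup>2 * poisson l z) - cnj p * (\<phi> z * P z))"
    unfolding fg
    by (simp only: diff_zero, intro Bochner_Integration.integral_cong refl,
        simp only: of_real_mult complex_norm_square, simp add: g_def P_def algebra_simps)
  also have "\<dots> = (LINT z|circle_measure. complex_of_real ((cmod (\<phi> z))\<^sup>2 * poisson l z)) - cnj p * (LINT z|circle_measure. \<phi> z * P z)"
    by (subst Bochner_Integration.integral_diff[OF i3 i4]) (simp only: integral_mult_right_zero)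
  also have "(LINT z|circle_measure. \<phi> z * P z) = p"
    using poisson_moment[OF \<phi> l, of 0] by (simp add: P_def p_def)
  also have "cnj p * p = complex_of_real ((cmod p)\<^sup>2)"
    by (subst complex_norm_square) simp
  finally have eq: "(LINT z|circle_measure. (\<phi> z - cnj (f z)) * cnj (g z)) =
     complex_of_real ((LINT z|circle_measure. (cmod (\<phi> z))\<^sup>2 * poisson l z) - (cmod p)\<^sup>2)"
    by (simp only: integral_complex_of_real of_real_diff)
  have "(LINT z|circle_measure. (cmod (\<phi> z))\<^sup>2 * poisson l z) - (cmod p)\<^sup>2
      \<le> cmod (LINT z|circle_measure. (\<phi> z - cnj (f z)) * cnj (g z))"
    unfolding eq norm_of_real by simp
  also have "\<dots> \<le> (LINT z|circle_measure. cmod ((\<phi> z - cnj (f z)) * cnj (g z)))"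
    by (rule integral_norm_bound)
  also have "\<dots> \<le> (LINT z|circle_measure. N * (M + cmod p) * poisson l z)"
  proof (rule integral_mono_AE)
    show "integrable circle_measure (\<lambda>z. cmod ((\<phi> z - cnj (f z)) * cnj (g z)))"
      using integrable_mult_bounded[OF integrable_cnj[OF gi] _ N(1)] by (simp add: mult.commute)
    show "integrable circle_measure (\<lambda>z. N * (M + cmod p) * poisson l z)"
      using integrable_poisson[OF l] by simp
    show "AE z in circle_measure. cmod ((\<phi> z - cnj (f z)) * cnj (g z)) \<le> N * (M + cmod p) * poisson l z"
      using N(1) bd
    proof eventually_elim
      case (elim z)
      have "cmod ((\<phi> z - cnj (f z)) * cnj (g z)) = cmod (\<phi> z - cnj (f z)) * cmod (\<phi> z - p) * poisson l z"
        using poisson_nonneg[OF l, of z] by (simp add: g_def P_def norm_mult del: complex_cnj_diff)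
      also have "\<dots> \<le> N * (M + cmod p) * poisson l z"
        using elim N(2) poisson_nonneg[OF l] by (intro mult_right_mono mult_mono) auto
      finally show ?case .
    qed
  qed
  also have "\<dots> = N * (M + cmod p)" using integral_poisson[OF l] by simp
  finally show ?thesis .
qed

text \<open>Nonnegativity of \<open>h\<close> allows discarding everything off the ball, which
  carries little Poisson mass when \<open>l\<close> is near \<zeta>; the bound \<open>B\<close>
  secures integrability. It is applied with \<open>h\<close> the squared modulus of \<phi>.\<close>

lemma poisson_local_lower_bound:
  assumes h: "h \<in> borel_measurable borel" and l: "cmod l < 1" and \<zeta>: "cmod \<zeta> = 1"
    and e: "e > 0" and le: "dist l \<zeta> < e / 2" and d: "0 \<le> d"
    and B: "AE z in circle_measure. 0 \<le> h z \<and> h z \<le> B"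
    and ge: "AE z in circle_measure. z \<in> ball \<zeta> e \<longrightarrow> d \<le> h z"
  shows "d * (1 - 8 * dist l \<zeta> / e\<^sup>2) \<le> (LINT z|circle_measure. h z * poisson l z)"
proof -
  have "d * (1 - 8 * dist l \<zeta> / e\<^sup>2) \<le> d * (LINT z|circle_measure. indicator (ball \<zeta> e) z * poisson l z)"
    by (intro mult_left_mono integral_poisson_near_ge l \<zeta> e le d) auto
  also have "\<dots> = (LINT z|circle_measure. d * (indicator (ball \<zeta> e) z * poisson l z))" by simp
  also have "\<dots> \<le> (LINT z|circle_measure. h z * poisson l z)"
  proof (rule integral_mono_AE)
    show "integrable circle_measure (\<lambda>z. d * (indicator (ball \<zeta> e) z * poisson l z))"
      by (intro integrable_mult_right Bochner_Integration.integrable_bound[OF integrable_poisson[OF l]])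
         (auto simp: indicator_def poisson_nonneg[OF l])
    show "integrable circle_measure (\<lambda>z. h z * poisson l z)"
    proof (rule Bochner_Integration.integrable_bound)
      show "integrable circle_measure (\<lambda>z. B * poisson l z)" using integrable_poisson[OF l] by simp
      show "AE z in circle_measure. norm (h z * poisson l z) \<le> norm (B * poisson l z)"
        using B by eventually_elim (auto simp: abs_mult poisson_nonneg[OF l] intro!: mult_right_mono)
    qed (use h in measurable)
    show "AE z in circle_measure. d * (indicator (ball \<zeta> e) z * poisson l z) \<le> h z * poisson l z"
      using ge B by eventually_elim (auto simp: indicator_def poisson_nonneg[OF l] intro!: mult_right_mono)
  qed
  finally show ?thesis .
qed

section \<open>Inner functions near their spectrum\<close>

lemma norm_blaschke_factor_le_1:
  assumes "\<And>b. x = Some b \<Longrightarrow> cmod b < 1" and z: "cmod z < 1"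
  shows "cmod (blaschke_factor x z) \<le> 1"
proof (cases x)
  case (Some b)
  have b: "cmod b < 1" using assms Some by simp
  \<comment> \<open>The identity showing that a Blaschke factor maps the disc into itself.\<close>
  have "(cmod (1 - cnj b * z))\<^sup>2 - (cmod (b - z))\<^sup>2 = (1 - (cmod b)\<^sup>2) * (1 - (cmod z)\<^sup>2)"
    unfolding cmod_power2 by (simp add: power2_eq_square algebra_simps)
  moreover have "0 \<le> (1 - (cmod b)\<^sup>2) * (1 - (cmod z)\<^sup>2)"
    using b z by (intro mult_nonneg_nonneg) (auto simp: abs_square_le_1)
  ultimately have "(cmod (b - z))\<^sup>2 \<le> (cmod (1 - cnj b * z))\<^sup>2" by linarith
  then have "cmod (b - z) \<le> cmod (1 - cnj b * z)" by (rule power2_le_imp_le) simp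
  then show ?thesis using Some z by (auto simp: norm_mult norm_divide divide_le_eq_1)
qed auto

text \<open>Over a common denominator the difference exposes the factor \<open>1 - cmod b\<close>,
  which the Blaschke condition makes summable. The case \<open>b = 0\<close> is separate because the
  factor is then \<open>z\<close> itself.\<close>

lemma norm_blaschke_factor_minus_1_le:
  assumes b: "cmod b < 1" and z: "cmod z < 1"
  shows "cmod (blaschke_factor (Some b) z - 1) \<le> (1 - cmod b) * (2 / (1 - cmod z))"
proof (cases "b = 0")
  case True
  have "cmod (z - 1) \<le> cmod z + 1" using norm_triangle_ineq4[of z 1] by simp
  also have "\<dots> \<le> 2 / (1 - cmod z)"
  proof -
    have "(cmod z + 1) * (1 - cmod z) \<le> 2 * 1" using z by (intro mult_mono) auto
    then show ?thesis using z by (simp add: pos_le_divide_eq)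
  qed
  finally show ?thesis using True by simp
next
  case False
  have ge: "1 - cmod z \<le> cmod (1 - cnj b * z)"
  proof -
    have "cmod b * cmod z \<le> 1 * cmod z" using b by (intro mult_right_mono) auto
    then show ?thesis using norm_triangle_ineq2[of 1 "cnj b * z"] by (simp add: norm_mult)
  qed
  then have n: "1 - cnj b * z \<noteq> 0" using z by auto
  have "blaschke_factor (Some b) z - 1 =
     - (of_real (1 - cmod b) * (b + of_real (cmod b) * z) / (b * (1 - cnj b * z)))"
    using False n complex_norm_square[of b] by (simp add: divide_simps power2_eq_square) (simp add: algebra_simps)
  then have "cmod (blaschke_factor (Some b) z - 1) =
      (1 - cmod b) * (cmod (b + of_real (cmod b) * z) / (cmod b * cmod (1 - cnj b * z)))"
    using b by (simp only: norm_minus_cancel norm_mult norm_divide norm_of_real) simp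
  also have "\<dots> \<le> (1 - cmod b) * (2 / (1 - cmod z))"
  proof (rule mult_left_mono)
    have "cmod (b + of_real (cmod b) * z) \<le> cmod b + cmod b * cmod z"
      using norm_triangle_ineq[of b "of_real (cmod b) * z"] by (simp add: norm_mult)
    also have "\<dots> \<le> cmod b * 2" using mult_left_mono[of "cmod z" 1 "cmod b"] z by simp
    finally have "cmod (b + of_real (cmod b) * z) / (cmod b * cmod (1 - cnj b * z))
       \<le> (cmod b * 2) / (cmod b * (1 - cmod z))"
      using False z ge by (intro frac_le mult_pos_pos mult_left_mono) auto
    then show "cmod (b + of_real (cmod b) * z) / (cmod b * cmod (1 - cnj b * z)) \<le> 2 / (1 - cmod z)"
      using False by simp
  qed (use b in simp)
  finally show ?thesis .
qed

text \<open>Absolute convergence by comparison with the Blaschke sum. Slots holding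
  \<open>None\<close> have factor 1 and contribute 0, so finite and infinite zero sequences are
  treated alike.\<close>

lemma convergent_blaschke_prod:
  assumes a: "blaschke_seq a" and z: "cmod z < 1"
  shows "convergent_prod (\<lambda>n. blaschke_factor (a n) z)"
proof (rule abs_convergent_prod_imp_convergent_prod, rule summable_imp_abs_convergent_prod)
  let ?s = "\<lambda>n. case a n of None \<Rightarrow> 0 | Some b \<Rightarrow> 1 - cmod b"
  have "summable (\<lambda>n. ?s n * (2 / (1 - cmod z)))"
    using a by (intro summable_mult2) (simp add: blaschke_seq_def)
  then show "summable (\<lambda>n. norm (blaschke_factor (a n) z - 1))"
  proof (rule summable_comparison_test'[where N = 0])
    fix n
    show "norm (norm (blaschke_factor (a n) z - 1)) \<le> ?s n * (2 / (1 - cmod z))"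
      using a z norm_blaschke_factor_minus_1_le[OF _ z]
      by (auto split: option.split simp: blaschke_seq_def simp del: blaschke_factor.simps(2))
  qed
qed

lemma blaschke_prod_LIMSEQ:
  assumes "blaschke_seq a" "cmod z < 1"
  shows "(\<lambda>n. \<Prod>i\<le>n. blaschke_factor (a i) z) \<longlonglongrightarrow> blaschke_prod a z"
  unfolding blaschke_prod_def by (intro convergent_prod_LIMSEQ convergent_blaschke_prod assms)

lemma norm_blaschke_prod_le_1:
  assumes a: "blaschke_seq a" and z: "cmod z < 1"
  shows "cmod (blaschke_prod a z) \<le> 1"
proof (rule LIMSEQ_le_const2[OF tendsto_norm[OF blaschke_prod_LIMSEQ[OF assms]]], intro exI allI impI)
  fix n
  show "cmod (\<Prod>i\<le>n. blaschke_factor (a i) z) \<le> 1"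
    unfolding prod_norm[symmetric]
    using a z by (intro prod_le_1 conjI norm_blaschke_factor_le_1) (auto simp: blaschke_seq_def)
qed

text \<open>From index \<open>n\<close> on, every partial product contains a factor vanishing at
  \<open>b\<close>.\<close>

lemma blaschke_prod_zero:
  assumes a: "blaschke_seq a" and n: "a n = Some b"
  shows "blaschke_prod a b = 0"
proof -
  have b: "cmod b < 1" using assms by (simp add: blaschke_seq_def)
  have "eventually (\<lambda>k. (\<Prod>i\<le>k. blaschke_factor (a i) b) = 0) sequentially"
    using eventually_ge_at_top[of n]
    by eventually_elim (auto intro!: prod_zero bexI[of _ n] simp: n)
  then have "(\<lambda>k. \<Prod>i\<le>k. blaschke_factor (a i) b) \<longlonglongrightarrow> 0"
    by (rule tendsto_eventually)
  with blaschke_prod_LIMSEQ[OF a b] show ?thesis by (rule LIMSEQ_unique)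
qed

section \<open>Singular inner functions and the Poisson integral of their measure\<close>

lemma Re_herglotz_kernel:
  assumes "cmod \<zeta> = 1"
  shows "Re ((\<zeta> + z) / (\<zeta> - z)) = poisson z \<zeta>"
proof -
  have "Re ((\<zeta> + z) / (\<zeta> - z)) = Re ((\<zeta> + z) * cnj (\<zeta> - z)) / (cmod (\<zeta> - z))\<^sup>2"
    by (metis complex_div_cnj Re_divide_of_real of_real_power)
  also have "Re ((\<zeta> + z) * cnj (\<zeta> - z)) = (cmod \<zeta>)\<^sup>2 - (cmod z)\<^sup>2"
    unfolding cmod_power2 by (simp add: power2_eq_square algebra_simps)
  finally show ?thesis using assms by (simp add: poisson_def)
qed

lemma singular_meas_AE_norm:
  assumes "singular_meas \<mu>"
  shows "AE \<zeta> in \<mu>. cmod \<zeta> = 1"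
proof -
  have "sets \<mu> = sets borel" using assms by (simp add: singular_meas_def)
  then show ?thesis using assms
    by (intro AE_I[of _ _ "UNIV - sphere 0 1"]) (auto simp: singular_meas_def)
qed

lemma integrable_poisson_singular:
  assumes \<mu>: "singular_meas \<mu>" and z: "cmod z < 1"
  shows "integrable \<mu> (poisson z)"
proof -
  interpret finite_measure \<mu> using \<mu> by (simp add: singular_meas_def)
  have [measurable_cong]: "sets \<mu> = sets borel" using \<mu> by (simp add: singular_meas_def)
  show ?thesis
    using singular_meas_AE_norm[OF \<mu>] poisson_nonneg[OF z] poisson_le[OF z]
    by (intro integrable_const_bound[where B = "(1 + cmod z) / (1 - cmod z)"])
       (auto elim!: eventually_mono)
qed

text \<open>The modulus of an exponential sees only the real part of the exponent, and \<mu> lives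
  on the circle, where the Herglotz kernel has the Poisson kernel as real part.\<close>

lemma norm_singular_inner:
  assumes \<mu>: "singular_meas \<mu>" and z: "cmod z < 1"
  shows "cmod (singular_inner \<mu> z) = exp (- (LINT \<zeta>|\<mu>. poisson z \<zeta>))"
proof -
  interpret finite_measure \<mu> using \<mu> by (simp add: singular_meas_def)
  have [measurable_cong]: "sets \<mu> = sets borel" using \<mu> by (simp add: singular_meas_def)
  have "integrable \<mu> (\<lambda>\<zeta>. (\<zeta> + z) / (\<zeta> - z))"
  proof (rule integrable_const_bound[where B = "2 / (1 - cmod z)"])
    show "AE \<zeta> in \<mu>. norm ((\<zeta> + z) / (\<zeta> - z)) \<le> 2 / (1 - cmod z)"
      using singular_meas_AE_norm[OF \<mu>]
    proof eventually_elim
      case (elim \<zeta>)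
      then show ?case
        using norm_triangle_ineq[of \<zeta> z] norm_triangle_ineq2[of \<zeta> z] z
        unfolding norm_divide by (intro frac_le) auto
    qed
  qed measurable
  then have "Re (LINT \<zeta>|\<mu>. (\<zeta> + z) / (\<zeta> - z)) = (LINT \<zeta>|\<mu>. Re ((\<zeta> + z) / (\<zeta> - z)))"
    by simp
  also have "\<dots> = (LINT \<zeta>|\<mu>. poisson z \<zeta>)"
    by (rule integral_cong_AE)
       (use singular_meas_AE_norm[OF \<mu>] Re_herglotz_kernel[of _ z] in \<open>auto elim!: eventually_mono\<close>)
  finally show ?thesis by (simp add: singular_inner_def norm_exp_eq_Re)
qed

text \<open>Integrate the Poisson means of the indicator of \<open>U\<close> against \<open>\<mu>\<close>, swap the integrals, and
  let the radius tend to 1 with Fatou's lemma.\<close>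

lemma poisson_bounded_imp_emeasure_le:
  assumes \<mu>: "singular_meas \<mu>" and e: "e > 0"
    and C: "\<And>l. cmod l < 1 \<Longrightarrow> dist l \<zeta>0 < e \<Longrightarrow> (LINT \<zeta>|\<mu>. poisson l \<zeta>) \<le> C"
    and U: "open U" "U \<subseteq> ball \<zeta>0 (e / 2)"
  shows "emeasure \<mu> U \<le> ennreal C * emeasure circle_measure U"
proof -
  interpret finite_measure \<mu> using \<mu> by (simp add: singular_meas_def)
  have sets [measurable_cong]: "sets \<mu> = sets borel" using \<mu> by (simp add: singular_meas_def)
  interpret pair_sigma_finite \<mu> circle_measure ..
  have [measurable]: "U \<in> sets borel" using U by auto
  define r where "r = (\<lambda>n. real n / real (Suc n))"
  have r: "0 \<le> r n" "r n < 1" for n by (auto simp: r_def)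
  have r1: "r \<longlonglongrightarrow> 1" unfolding r_def by (rule LIMSEQ_n_over_Suc_n)
  define u where "u = (\<lambda>n \<zeta>. \<integral>\<^sup>+ \<xi>. indicator U \<xi> * ennreal (pkernel (r n) \<zeta> \<xi>) \<partial>circle_measure)"
  have [measurable]: "u n \<in> borel_measurable \<mu>" for n unfolding u_def by measurable
  have "emeasure \<mu> U = (\<integral>\<^sup>+ \<zeta>. indicator U \<zeta> \<partial>\<mu>)" by simp
  \<comment> \<open>On \<open>U\<close> the means \<open>u n\<close> tend to 1; off \<open>U\<close>
    the left side is 0.\<close>
  also have "\<dots> \<le> (\<integral>\<^sup>+ \<zeta>. liminf (\<lambda>n. u n \<zeta>) \<partial>\<mu>)"
  proof (rule nn_integral_mono_AE)
    show "AE \<zeta> in \<mu>. indicator U \<zeta> \<le> liminf (\<lambda>n. u n \<zeta>)"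
      using singular_meas_AE_norm[OF \<mu>]
    proof eventually_elim
      case (elim \<zeta>)
      show ?case
      proof (cases "\<zeta> \<in> U")
        case True
        have "u n \<zeta> = ennreal (LINT \<xi>|circle_measure. indicator U \<xi> * pkernel (r n) \<zeta> \<xi>)" for n
        proof -
          have "u n \<zeta> = (\<integral>\<^sup>+ \<xi>. ennreal (indicator U \<xi> * pkernel (r n) \<zeta> \<xi>) \<partial>circle_measure)"
            unfolding u_def by (intro nn_integral_cong) (auto simp: indicator_def)
          also have "\<dots> = ennreal (LINT \<xi>|circle_measure. indicator U \<xi> * pkernel (r n) \<zeta> \<xi>)"
            using r by (intro nn_integral_eq_integral integrable_indicator_pkernel) (auto simp: pkernel_bounds)
          finally show ?thesis .
        qed
        moreover have "(\<lambda>n. ennreal (LINT \<xi>|circle_measure. indicator U \<xi> * pkernel (r n) \<zeta> \<xi>)) \<longlonglongrightarrow> ennreal 1"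
          using elim by (intro tendsto_ennrealI pkernel_open_tendsto_1 r r1 U True)
        ultimately have "(\<lambda>n. u n \<zeta>) \<longlonglongrightarrow> 1" by simp
        then have "liminf (\<lambda>n. u n \<zeta>) = 1" by (intro lim_imp_Liminf) auto
        then show ?thesis using True by simp
      qed simp
    qed
  qed
  also have "\<dots> \<le> liminf (\<lambda>n. \<integral>\<^sup>+ \<zeta>. u n \<zeta> \<partial>\<mu>)"
    by (rule nn_integral_liminf) measurable
  also have "\<dots> \<le> ennreal C * emeasure circle_measure U"
  proof (rule Liminf_le)
    \<comment> \<open>A point of \<open>U\<close> is within \<open>e / 2\<close> of the centre, and
      moving it radially by \<open>1 - r n < e / 2\<close> stays within \<open>e\<close>, where
      \<open>C\<close> is available.\<close>
    have "eventually (\<lambda>n. 1 - e / 2 < r n) sequentially"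
      using order_tendstoD(1)[OF r1, of "1 - e / 2"] e by simp
    then show "eventually (\<lambda>n. (\<integral>\<^sup>+ \<zeta>. u n \<zeta> \<partial>\<mu>) \<le> ennreal C * emeasure circle_measure U) sequentially"
    proof eventually_elim
      case (elim n)
      have "(\<integral>\<^sup>+ \<zeta>. u n \<zeta> \<partial>\<mu>) =
         (\<integral>\<^sup>+ \<xi>. (\<integral>\<^sup>+ \<zeta>. indicator U \<xi> * ennreal (pkernel (r n) \<zeta> \<xi>) \<partial>\<mu>) \<partial>circle_measure)"
        unfolding u_def by (rule Fubini'[symmetric]) measurable
      \<comment> \<open>By symmetry of the kernel the inner integral is the Poisson integral of
        \<mu> at \<open>r n * \<xi>\<close>.\<close>
      also have "\<dots> = (\<integral>\<^sup>+ \<xi>. indicator U \<xi> * (\<integral>\<^sup>+ \<zeta>. ennreal (pkernel (r n) \<xi> \<zeta>) \<partial>\<mu>) \<partial>circle_measure)"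
        by (intro nn_integral_cong) (subst pkernel_commute, rule nn_integral_cmult, measurable)
      also have "\<dots> \<le> (\<integral>\<^sup>+ \<xi>. ennreal C * indicator U \<xi> \<partial>circle_measure)"
      proof (rule nn_integral_mono_AE)
        show "AE \<xi> in circle_measure. indicator U \<xi> * (\<integral>\<^sup>+ \<zeta>. ennreal (pkernel (r n) \<xi> \<zeta>) \<partial>\<mu>)
            \<le> ennreal C * indicator U \<xi>"
          using AE_circle_norm
        proof eventually_elim
          case (elim \<xi>)
          show ?case
          proof (cases "\<xi> \<in> U")
            case True
            let ?l = "of_real (r n) * \<xi>"
            have l: "cmod ?l < 1" using r[of n] elim by (simp add: norm_mult)
            have "?l - \<xi> = of_real (r n - 1) * \<xi>" by (simp add: algebra_simps)
            then have "dist ?l \<xi> = 1 - r n"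
              using elim r(2)[of n] by (simp add: dist_norm norm_mult del: of_real_diff)
            then have "dist ?l \<zeta>0 < e"
              using dist_triangle[of ?l \<zeta>0 \<xi>] \<open>1 - e / 2 < r n\<close> True U by (auto simp: dist_commute subset_iff)
            have "(\<integral>\<^sup>+ \<zeta>. ennreal (pkernel (r n) \<xi> \<zeta>) \<partial>\<mu>) = (\<integral>\<^sup>+ \<zeta>. ennreal (poisson ?l \<zeta>) \<partial>\<mu>)"
              using singular_meas_AE_norm[OF \<mu>]
              by (intro nn_integral_cong_AE) (auto simp: pkernel_eq_poisson[OF r elim] elim!: eventually_mono)
            also have "\<dots> = ennreal (LINT \<zeta>|\<mu>. poisson ?l \<zeta>)"
              using poisson_nonneg[OF l] by (intro nn_integral_eq_integral integrable_poisson_singular[OF \<mu> l]) auto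
            also have "\<dots> \<le> ennreal C" using C[OF l \<open>dist ?l \<zeta>0 < e\<close>] by (rule ennreal_leI)
            finally show ?thesis using True by simp
          qed simp
        qed
      qed
      also have "\<dots> = ennreal C * emeasure circle_measure U"
        by (rule nn_integral_cmult_indicator) simp
      finally show ?case .
    qed
  qed simp
  finally show ?thesis .
qed

text \<open>Otherwise the Poisson integral of \<mu> is bounded near \<open>\<zeta>0\<close>, so
  \<mu> is dominated there by a multiple of Lebesgue measure. But \<mu> is carried by a Lebesgue
  null set \<open>A\<close>, so a whole ball around \<open>\<zeta>0\<close> would be null for
  \<mu>.\<close>

lemma singular_inner_small_near_support:
  assumes \<mu>: "singular_meas \<mu>" and s: "\<zeta>0 \<in> measure_support \<mu>" and e: "e > 0" and h: "h > 0"
  shows "\<exists>l. cmod l < 1 \<and> dist l \<zeta>0 < e \<and> cmod (singular_inner \<mu> l) < h"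
proof (rule ccontr)
  assume "\<not> ?thesis"
  then have ge: "h \<le> cmod (singular_inner \<mu> l)" if "cmod l < 1" "dist l \<zeta>0 < e" for l
    using that by (meson not_less)
  have sets [measurable_cong]: "sets \<mu> = sets borel" using \<mu> by (simp add: singular_meas_def)
  \<comment> \<open>The direct bound is \<open>- ln h\<close>, which is negative for
    \<open>h > 1\<close>; the absolute value is a nonnegative constant fit for
    \<open>ennreal\<close>.\<close>
  have C: "(LINT \<zeta>|\<mu>. poisson l \<zeta>) \<le> \<bar>ln h\<bar>" if "cmod l < 1" "dist l \<zeta>0 < e" for l
  proof -
    have "h \<le> exp (- (LINT \<zeta>|\<mu>. poisson l \<zeta>))"
      using ge[OF that] norm_singular_inner[OF \<mu> that(1)] by simp
    then have "ln h \<le> ln (exp (- (LINT \<zeta>|\<mu>. poisson l \<zeta>)))" using h by (subst ln_le_cancel_iff) auto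
    then have "ln h \<le> - (LINT \<zeta>|\<mu>. poisson l \<zeta>)" by simp
    then show ?thesis by linarith
  qed
  obtain A where A [measurable]: "A \<in> sets borel" and A0: "emeasure circle_measure A = 0"
    and Ac: "emeasure \<mu> (UNIV - A) = 0"
    using \<mu> by (auto simp: singular_meas_def)
  let ?B = "ball \<zeta>0 (e / 2)"
  have "emeasure \<mu> (A \<inter> ?B) \<le> 0"
  proof (rule ennreal_le_epsilon)
    fix d :: real assume d: "d > 0"
    \<comment> \<open>The excess is chosen so that multiplying by \<open>\<bar>ln h\<bar>\<close>
      leaves at most \<open>d\<close>; the added 1 covers \<open>h = 1\<close>. The cover is then
      cut down to the half ball, where the comparison with Lebesgue measure holds.\<close>
    obtain U where U: "open U" "A \<inter> ?B \<subseteq> U"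
        "emeasure circle_measure (U - A \<inter> ?B) < ennreal (d / (\<bar>ln h\<bar> + 1))"
      using outer_regular_circle[of "A \<inter> ?B" "d / (\<bar>ln h\<bar> + 1)"] d by auto
    have [measurable]: "U \<in> sets borel" using U by auto
    have "emeasure circle_measure (U \<inter> ?B) \<le> emeasure circle_measure ((U - A \<inter> ?B) \<union> A)"
      by (intro emeasure_mono) auto
    also have "\<dots> \<le> emeasure circle_measure (U - A \<inter> ?B) + emeasure circle_measure A"
      by (intro emeasure_subadditive) auto
    also have "\<dots> \<le> ennreal (d / (\<bar>ln h\<bar> + 1))" using U A0 by simp
    finally have m: "emeasure circle_measure (U \<inter> ?B) \<le> ennreal (d / (\<bar>ln h\<bar> + 1))" .
    have "emeasure \<mu> (A \<inter> ?B) \<le> emeasure \<mu> (U \<inter> ?B)"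
      using U sets by (intro emeasure_mono) auto
    also have "\<dots> \<le> ennreal \<bar>ln h\<bar> * emeasure circle_measure (U \<inter> ?B)"
      by (rule poisson_bounded_imp_emeasure_le[OF \<mu> e C]) (use U in auto)
    also have "\<dots> \<le> ennreal \<bar>ln h\<bar> * ennreal (d / (\<bar>ln h\<bar> + 1))"
      using m by (rule mult_left_mono) simp
    also have "\<dots> = ennreal (\<bar>ln h\<bar> * (d / (\<bar>ln h\<bar> + 1)))"
      using d by (intro ennreal_mult[symmetric]) auto
    also have "\<dots> \<le> ennreal d"
      using d by (intro ennreal_leI) (simp add: field_simps)
    finally show "emeasure \<mu> (A \<inter> ?B) \<le> 0 + ennreal d" by simp
  qed
  moreover have "emeasure \<mu> ?B \<le> emeasure \<mu> (A \<inter> ?B) + emeasure \<mu> (UNIV - A)"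
  proof -
    have "emeasure \<mu> ?B \<le> emeasure \<mu> ((A \<inter> ?B) \<union> (UNIV - A))"
      using sets by (intro emeasure_mono) auto
    also have "\<dots> \<le> emeasure \<mu> (A \<inter> ?B) + emeasure \<mu> (UNIV - A)"
      using sets by (intro emeasure_subadditive) auto
    finally show ?thesis .
  qed
  ultimately have "emeasure \<mu> ?B = 0" using Ac by simp
  moreover have "emeasure \<mu> ?B > 0" using s e by (simp add: measure_support_def)
  ultimately show False by simp
qed

text \<open>Near an accumulation point the zeros themselves serve; near the support of \<mu> the
  singular factor is small somewhere, and the Blaschke product has modulus at most 1.\<close>

lemma inner_small_near_spectrum:
  assumes I: "inner_decomp I c a \<mu>" and \<zeta>: "\<zeta> \<in> inner_spectrum a \<mu>" and e: "e > 0" and h: "h > 0"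
  shows "\<exists>l. cmod l < 1 \<and> dist l \<zeta> < e \<and> cmod (disc_ext I l) < h"
proof -
  have a: "blaschke_seq a" and \<mu>: "singular_meas \<mu>" and c: "cmod c = 1"
    and eq: "\<And>z. cmod z < 1 \<Longrightarrow> disc_ext I z = c * blaschke_prod a z * singular_inner \<mu> z"
    using I by (auto simp: inner_decomp_def)
  consider "\<zeta> islimpt {b. \<exists>n. a n = Some b}" | "\<zeta> \<in> measure_support \<mu>"
    using \<zeta> by (auto simp: inner_spectrum_def)
  then show ?thesis
  proof cases
    case 1
    then obtain b n where b: "a n = Some b" "dist b \<zeta> < e" using e by (auto simp: islimpt_approachable)
    then have "cmod b < 1" using a by (simp add: blaschke_seq_def)
    then show ?thesis using b h eq[of b] blaschke_prod_zero[OF a b(1)] by (intro exI[of _ b]) simp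
  next
    case 2
    obtain l where l: "cmod l < 1" "dist l \<zeta> < e" "cmod (singular_inner \<mu> l) < h"
      using singular_inner_small_near_support[OF \<mu> 2 e h] by blast
    have "cmod (disc_ext I l) \<le> 1 * cmod (singular_inner \<mu> l)"
      unfolding eq[OF l(1)] norm_mult using c norm_blaschke_prod_le_1[OF a l(1)]
      by (intro mult_right_mono) auto
    then show ?thesis using l by (intro exI[of _ l]) simp
  qed
qed

section \<open>Saturation\<close>

lemma linf_norm_nonneg: "0 \<le> linf_norm f"
proof -
  let ?s = "esssup circle_measure (\<lambda>z. ereal (cmod (f z)))"
  have "AE z in circle_measure. ereal (cmod (f z)) \<le> ?s" by (rule esssup_AE)
  \<comment> \<open>A statement free of \<open>z\<close> that holds almost everywhere for a
    probability measure simply holds.\<close>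
  then have "AE z in circle_measure. 0 \<le> ?s"
    by eventually_elim (rule order_trans[rotated], auto)
  then show ?thesis by (simp add: linf_norm_def real_of_ereal_pos)
qed

text \<open>Membership in \<open>Linf\<close> matters because \<open>real_of_ereal\<close> sends an
  infinite essential supremum to 0.\<close>

lemma AE_le_linf_norm:
  assumes "f \<in> Linf"
  shows "AE z in circle_measure. cmod (f z) \<le> linf_norm f"
proof -
  let ?s = "esssup circle_measure (\<lambda>z. ereal (cmod (f z)))"
  have "?s < \<infinity>" using assms by (simp add: Linf_def)
  have ae: "AE z in circle_measure. ereal (cmod (f z)) \<le> ?s" by (rule esssup_AE)
  show ?thesis using ae
  proof eventually_elim
    case (elim z)
    then have "\<bar>?s\<bar> \<noteq> \<infinity>" using \<open>?s < \<infinity>\<close> by auto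
    then show ?case using elim unfolding linf_norm_def by (cases ?s) auto
  qed
qed

lemma Linf_I:
  assumes f: "f \<in> borel_measurable borel" and B: "AE z in circle_measure. cmod (f z) \<le> B"
  shows "f \<in> Linf"
proof -
  have "esssup circle_measure (\<lambda>z. ereal (cmod (f z))) \<le> ereal B"
    using f B by (intro esssup_I) auto
  then show ?thesis using f by (auto simp: Linf_def)
qed

lemma Hinf_subset_H1: "Hinf \<subseteq> H1"
proof
  fix f assume "f \<in> Hinf"
  then have f: "f \<in> Linf" "\<forall>n<0. fourier_coeff f n = 0" by (auto simp: Hinf_def)
  have "integrable circle_measure f"
    using f(1) by (intro integrable_bounded_circle[OF _ AE_le_linf_norm[OF f(1)]]) (simp add: Linf_def)
  then show "f \<in> H1" using f(2) by (simp add: H1_def)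
qed

text \<open>Combine \<open>poisson_duality_bound\<close> with
  \<open>poisson_local_lower_bound\<close> at \<open>l n\<close>: in the limit the values of the
  extension and the lost Poisson mass disappear, leaving
  \<open>(M * d)\<^sup>2 \<le> N * M\<close>.\<close>

lemma linf_norm_ge_of_vanishing_seq:
  assumes \<phi>: "\<phi> \<in> Hinf" and f: "f \<in> Hinf" and \<zeta>: "cmod \<zeta> = 1" and e: "e > 0" and d: "0 \<le> d"
    and ge: "AE z in circle_measure. z \<in> ball \<zeta> e \<longrightarrow> linf_norm \<phi> * d \<le> cmod (\<phi> z)"
    and l: "\<And>n. cmod (l n) < 1" "l \<longlonglongrightarrow> \<zeta>" "(\<lambda>n. disc_ext \<phi> (l n)) \<longlonglongrightarrow> 0"
  shows "linf_norm \<phi> * d\<^sup>2 \<le> linf_norm (\<lambda>z. \<phi> z - cnj (f z))"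
proof -
  define M where "M = linf_norm \<phi>"
  define N where "N = linf_norm (\<lambda>z. \<phi> z - cnj (f z))"
  have M0: "0 \<le> M" and N0: "0 \<le> N" by (simp_all add: M_def N_def linf_norm_nonneg)
  have H: "\<phi> \<in> H1" "f \<in> H1" using \<phi> f Hinf_subset_H1 by auto
  then have [measurable]: "\<phi> \<in> borel_measurable borel" "f \<in> borel_measurable borel"
    by (auto simp: H1_def)
  have M: "AE z in circle_measure. cmod (\<phi> z) \<le> M"
    unfolding M_def using \<phi> by (intro AE_le_linf_norm) (simp add: Hinf_def)
  have L: "AE z in circle_measure. cmod (f z) \<le> linf_norm f"
    using f by (intro AE_le_linf_norm) (simp add: Hinf_def)
  have "AE z in circle_measure. cmod (\<phi> z - cnj (f z)) \<le> M + linf_norm f"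
    using M L
  proof eventually_elim
    case (elim z)
    then show ?case using norm_triangle_ineq4[of "\<phi> z" "cnj (f z)"] by simp
  qed
  then have N: "AE z in circle_measure. cmod (\<phi> z - cnj (f z)) \<le> N"
    unfolding N_def by (intro AE_le_linf_norm Linf_I) auto
  have "(M * d)\<^sup>2 \<le> N * M"
  proof (rule LIMSEQ_le)
    have "(\<lambda>n. (M * d)\<^sup>2 * (1 - 8 * dist (l n) \<zeta> / e\<^sup>2) - (cmod (disc_ext \<phi> (l n)))\<^sup>2)
       \<longlonglongrightarrow> (M * d)\<^sup>2 * (1 - 8 * dist \<zeta> \<zeta> / e\<^sup>2) - (cmod 0)\<^sup>2"
      using e by (intro tendsto_intros l) auto
    then show "(\<lambda>n. (M * d)\<^sup>2 * (1 - 8 * dist (l n) \<zeta> / e\<^sup>2) - (cmod (disc_ext \<phi> (l n)))\<^sup>2) \<longlonglongrightarrow> (M * d)\<^sup>2"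
      by simp
    have "(\<lambda>n. N * (M + cmod (disc_ext \<phi> (l n)))) \<longlonglongrightarrow> N * (M + cmod 0)"
      by (intro tendsto_intros l)
    then show "(\<lambda>n. N * (M + cmod (disc_ext \<phi> (l n)))) \<longlonglongrightarrow> N * M" by simp
    obtain n0 where n0: "\<And>n. n \<ge> n0 \<Longrightarrow> dist (l n) \<zeta> < e / 2"
      using metric_LIMSEQ_D[OF l(2), of "e / 2"] e by auto
    show "\<exists>n0. \<forall>n\<ge>n0. (M * d)\<^sup>2 * (1 - 8 * dist (l n) \<zeta> / e\<^sup>2) - (cmod (disc_ext \<phi> (l n)))\<^sup>2
        \<le> N * (M + cmod (disc_ext \<phi> (l n)))"
    proof (intro exI allI impI)
      fix n assume "n \<ge> n0"
      have "(M * d)\<^sup>2 * (1 - 8 * dist (l n) \<zeta> / e\<^sup>2) \<le> (LINT z|circle_measure. (cmod (\<phi> z))\<^sup>2 * poisson (l n) z)"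
      proof (rule poisson_local_lower_bound[OF _ l(1) \<zeta> e n0[OF \<open>n \<ge> n0\<close>], where B = "M\<^sup>2"])
        show "AE z in circle_measure. 0 \<le> (cmod (\<phi> z))\<^sup>2 \<and> (cmod (\<phi> z))\<^sup>2 \<le> M\<^sup>2"
          using M by eventually_elim (simp add: power_mono)
        show "AE z in circle_measure. z \<in> ball \<zeta> e \<longrightarrow> (M * d)\<^sup>2 \<le> (cmod (\<phi> z))\<^sup>2"
          using ge by eventually_elim (use M0 d in \<open>auto simp: M_def intro!: power_mono\<close>)
      qed auto
      then show "(M * d)\<^sup>2 * (1 - 8 * dist (l n) \<zeta> / e\<^sup>2) - (cmod (disc_ext \<phi> (l n)))\<^sup>2
          \<le> N * (M + cmod (disc_ext \<phi> (l n)))"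
        using poisson_duality_bound[OF H(1) M H(2) L N N0 l(1), of n] by linarith
    qed
  qed
  then have "M * (M * d\<^sup>2) \<le> M * N" by (simp add: power2_eq_square mult_ac)
  \<comment> \<open>Cancel \<open>M\<close> if it is nonzero; for \<open>M = 0\<close> the claim is
    \<open>0 \<le> N\<close>.\<close>
  then have "M * d\<^sup>2 \<le> N"
    using M0 N0 by (cases "M = 0") auto
  then show ?thesis by (simp add: M_def N_def)
qed

theorem theorem4:
  fixes \<phi> \<Phi> I :: "complex \<Rightarrow> complex"
    and c :: complex and a :: "nat \<Rightarrow> complex option" and \<mu> :: "complex measure"
  assumes "\<phi> \<in> Hinf"
    and "inner_fun I"
    and "outer_fun \<Phi>"
    and "AE z in circle_measure. \<phi> z = \<Phi> z * I z"
    and "inner_decomp I c a \<mu>"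
    and "\<forall>\<delta>. 0 < \<delta> \<and> \<delta> < 1 \<longrightarrow>
           (top_of_set (sphere 0 1) interior_of Lplus \<Phi> \<delta>) \<inter> inner_spectrum a \<mu> \<noteq> {}"
  shows "saturated \<phi>"
proof -
  have Phi: "\<Phi> \<in> H1" using assms(3) by (simp add: outer_fun_def)
  have I: "I \<in> H1" "AE z in circle_measure. cmod (I z) = 1"
    using assms(2) Hinf_subset_H1 by (auto simp: inner_fun_def)
  have [measurable]: "\<phi> \<in> borel_measurable borel" "\<Phi> \<in> borel_measurable borel"
    using assms(1) Phi Hinf_subset_H1 by (auto simp: H1_def)
  \<comment> \<open>Because \<open>I\<close> is unimodular, norm and level sets of the outer factor
    carry over to \<phi>.\<close>
  have mod_eq: "AE z in circle_measure. cmod (\<Phi> z) = cmod (\<phi> z)"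
    using assms(4) I(2) by eventually_elim (simp add: norm_mult)
  have norm_eq: "linf_norm \<Phi> = linf_norm \<phi>"
  proof -
    have "AE z in circle_measure. ereal (cmod (\<Phi> z)) = ereal (cmod (\<phi> z))"
      using mod_eq by eventually_elim simp
    then show ?thesis
      unfolding linf_norm_def by (intro arg_cong[where f = real_of_ereal] esssup_AE_cong) auto
  qed
  have PhiM: "AE z in circle_measure. cmod (\<Phi> z) \<le> linf_norm \<phi>"
    using mod_eq AE_le_linf_norm[of \<phi>] assms(1) by (auto simp: Hinf_def elim: eventually_elim2)
  have key: "linf_norm \<phi> * d\<^sup>2 \<le> linf_norm (\<lambda>z. \<phi> z - cnj (f z))"
    if f: "f \<in> Hinf0" and d: "0 < d" "d < 1" for f d
  proof -
    obtain \<zeta> where \<zeta>: "\<zeta> \<in> top_of_set (sphere 0 1) interior_of Lplus \<Phi> d" "\<zeta> \<in> inner_spectrum a \<mu>"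
      using assms(6) d by blast
    then obtain T where T: "openin (top_of_set (sphere 0 1)) T" "\<zeta> \<in> T" "T \<subseteq> Lplus \<Phi> d"
      by (auto simp: interior_of_def)
    \<comment> \<open>Interiority relative to the circle yields an arc around \<zeta> on which
      \<Phi> is large.\<close>
    then obtain e where e: "e > 0" "ball \<zeta> e \<inter> sphere 0 1 \<subseteq> T"
      by (auto simp: openin_contains_ball)
    have "cmod \<zeta> = 1" using T by (auto simp: Lplus_def)
    \<comment> \<open>One vanishing scale serves both as distance and as threshold, so the chosen
      points tend to \<zeta> while the extension of \<open>I\<close> tends to 0.\<close>
    have "\<exists>l. cmod l < 1 \<and> dist l \<zeta> < 1 / Suc n \<and> cmod (disc_ext I l) < 1 / Suc n" for n
      by (rule inner_small_near_spectrum[OF assms(5) \<zeta>(2)]) auto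
    then obtain l where l: "\<And>n. cmod (l n) < 1" "\<And>n. dist (l n) \<zeta> < 1 / Suc n"
        "\<And>n. cmod (disc_ext I (l n)) < 1 / Suc n"
      by metis
    have inv: "(\<lambda>n. 1 / real (Suc n)) \<longlonglongrightarrow> 0"
      using LIMSEQ_inverse_real_of_nat by (simp add: inverse_eq_divide)
    show ?thesis
    proof (rule linf_norm_ge_of_vanishing_seq[OF assms(1) _ \<open>cmod \<zeta> = 1\<close> e(1)])
      show "f \<in> Hinf" using f by (simp add: Hinf0_def)
      show "AE z in circle_measure. z \<in> ball \<zeta> e \<longrightarrow> linf_norm \<phi> * d \<le> cmod (\<phi> z)"
        using AE_circle_norm mod_eq
      proof eventually_elim
        case (elim z)
        then show ?case using e(2) T(3) norm_eq by (force simp: Lplus_def)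
      qed
      show "l \<longlonglongrightarrow> \<zeta>"
        unfolding tendsto_dist_iff[of l]
        by (rule Lim_null_comparison[OF always_eventually inv]) (use l(2) in \<open>simp add: less_imp_le\<close>)
      show "(\<lambda>n. disc_ext \<phi> (l n)) \<longlonglongrightarrow> 0"
      proof (rule Lim_null_comparison[OF always_eventually], intro allI)
        fix n
        have "cmod (disc_ext \<phi> (l n)) \<le> linf_norm \<phi> * cmod (disc_ext I (l n))"
          by (rule disc_ext_mult_bound[OF Phi PhiM I(1) _ assms(4) l(1)]) simp
        also have "\<dots> \<le> linf_norm \<phi> * (1 / Suc n)"
          using l(3)[of n] by (intro mult_left_mono linf_norm_nonneg) auto
        finally show "cmod (disc_ext \<phi> (l n)) \<le> linf_norm \<phi> * (1 / Suc n)" .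
        show "(\<lambda>n. linf_norm \<phi> * (1 / Suc n)) \<longlonglongrightarrow> 0"
          using tendsto_mult_left[OF inv, of "linf_norm \<phi>"] by simp
      qed
    qed (use l d in auto)
  qed
  have lower: "linf_norm \<phi> \<le> linf_norm (\<lambda>z. \<phi> z - cnj (f z))" if "f \<in> Hinf0" for f
  proof (rule LIMSEQ_le_const2)
    \<comment> \<open>Let \<open>d\<close> be \<open>(n + 1) / (n + 2)\<close>; the shift keeps it
      strictly between 0 and 1 even at \<open>n = 0\<close>.\<close>
    have "(\<lambda>n. linf_norm \<phi> * (real (Suc n) / real (Suc (Suc n)))\<^sup>2) \<longlonglongrightarrow> linf_norm \<phi> * 1\<^sup>2"
      by (intro tendsto_intros LIMSEQ_Suc[OF LIMSEQ_n_over_Suc_n])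
    then show "(\<lambda>n. linf_norm \<phi> * (real (Suc n) / real (Suc (Suc n)))\<^sup>2) \<longlonglongrightarrow> linf_norm \<phi>" by simp
    show "\<exists>n0. \<forall>n\<ge>n0. linf_norm \<phi> * (real (Suc n) / real (Suc (Suc n)))\<^sup>2 \<le> linf_norm (\<lambda>z. \<phi> z - cnj (f z))"
      by (intro exI allI impI key[OF that]) auto
  qed
  \<comment> \<open>The competitor 0 attains the lower bound, so the infimum is a minimum.\<close>
  have zero: "(\<lambda>_. 0) \<in> Hinf0"
    by (auto simp: Hinf0_def Hinf_def fourier_coeff_def intro!: Linf_I[of _ 0])
  show ?thesis
    unfolding saturated_def
  proof (rule cInf_eq_minimum[symmetric])
    show "linf_norm \<phi> \<in> {linf_norm (\<lambda>z. \<phi> z - cnj (f z)) |f. f \<in> Hinf0}"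
      using zero by force
  qed (use lower in auto)
qed

end
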